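(* In the setting below, if $q\le\frac{1}{2e\,\tau(\tilde n)}$, then the set $M_4$ is a feasible (independent) set with probability at least $1-\frac3n$.
   Context: Edge-weighted conflict graph: a finite node set $V$ with directed weights $w(u,v)\in[0,1]$, $w(v,v)=0$, and $\bar w(u,v)=w(u,v)+w(v,u)$. $S\subseteq V$ is independent (feasible) if $\sum_{u\in S}w(u,v)<1$ for all $v\in S$. The inductive independence number $\rho$ is the smallest number for which there is a total order $\prec$ on $V$ such that for every independent set $S$ and every $v\in V$, $\sum_{u\in S,\,u\succ v}\bar w(u,v)\le\rho$. Graph sampling model with $\{0,1\}$-weights (parameter $c\ge1$): random subsets $V^I,V^S\subseteq V$, the pairs of events $(v\in V^I,v\in V^S)$ independent across nodes (possibly correlated for the same node), with $\frac1c\Pr[v\in V^S]\le\Pr[v\in V^I]\le c\Pr[v\in V^S]$. Standing assumption: $\Pr[v\notin V^S,\ v\notin V^I]=0$ for each $v$, and $n=|V^S\cup V^I|$. Logarithms are base 2. Let $\tau(m)=\frac{3(1+c)^3+c}{c}(2\rho\lceil\log m\rceil+1)$ and $\tilde n=(c+2)|V^S|$. Algorithm: $M_1$: go through $v\in V^S$ in increasing order $\prec$, adding $v$ if $\sum_{u\in M_1}\bar w(u,v)<1$. Then for each $v\in V^I$ in (adversarial) arrival order: add $v$ to $M_2$ if $\sum_{u\in M_1,u\prec v}\bar w(u,v)<1$; if $v\in M_2$, add $v$ to $M_3$ independently with probability $q$; if $v\in M_3$ and there is no $u\in M_3$ (among the nodes added so far) with $\bar w(u,v)\ge\frac{1}{4e\log\tilde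 n}$, add $v$ to $M_4$. $M_4$ is the output. *)

theory Defs
  imports "HOL-Probability.Probability" "HOL-Combinatorics.Multiset_Permutations"
begin

definition conflict_graph :: "'a set \<Rightarrow> ('a \<Rightarrow> 'a \<Rightarrow> real) \<Rightarrow> bool" where
  "conflict_graph V w \<longleftrightarrow>
     finite V \<and> (\<forall>u\<in>V. \<forall>v\<in>V. 0 \<le> w u v \<and> w u v \<le> 1) \<and> (\<forall>v\<in>V. w v v = 0)"

definition wbar :: "('a \<Rightarrow> 'a \<Rightarrow> real) \<Rightarrow> 'a \<Rightarrow> 'a \<Rightarrow> real" where
  "wbar w u v = w u v + w v u"

definition independent_set :: "'a set \<Rightarrow> ('a \<Rightarrow> 'a \<Rightarrow> real) \<Rightarrow> 'a set \<Rightarrow> bool" where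
  "independent_set V w S \<longleftrightarrow> S \<subseteq> V \<and> (\<forall>v\<in>S. (\<Sum>u\<in>S. w u v) < 1)"

text \<open>Total orders are reflexive relations in the sense of \<^const>\<open>linear_order_on\<close>;
  this is the associated strict order.\<close>

definition prec :: "'a rel \<Rightarrow> 'a \<Rightarrow> 'a \<Rightarrow> bool" where
  "prec ord u v \<longleftrightarrow> (u, v) \<in> ord \<and> u \<noteq> v"

definition inductive_order :: "'a set \<Rightarrow> ('a \<Rightarrow> 'a \<Rightarrow> real) \<Rightarrow> 'a rel \<Rightarrow> real \<Rightarrow> bool" where
  "inductive_order V w ord r \<longleftrightarrow>
     linear_order_on V ord \<and>
     (\<forall>S v. independent_set V w S \<and> v \<in> V \<longrightarrow> (\<Sum>u\<in>{u\<in>S. prec ord v u}. wbar w u v) \<le> r)"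

definition inductive_independence_number :: "'a set \<Rightarrow> ('a \<Rightarrow> 'a \<Rightarrow> real) \<Rightarrow> real" where
  "inductive_independence_number V w = (LEAST r. \<exists>ord. inductive_order V w ord r)"

text \<open>For a nonempty graph the minimum is attained, so the \<^const>\<open>Least\<close> above is meaningful.\<close>

lemma inductive_independence_number_attained:
  assumes "conflict_graph V w" and "V \<noteq> {}"
  shows "\<exists>ord. inductive_order V w ord (inductive_independence_number V w)"
    and "inductive_order V w ord r \<Longrightarrow> inductive_independence_number V w \<le> r"
proof -
  have fin: "finite V" using assms(1) by (simp add: conflict_graph_def)
  define I where "I = {S. independent_set V w S} \<times> V"
  define f where "f ord = (\<lambda>(S, v). \<Sum>u\<in>{u\<in>S. prec ord v u}. wbar w u v)" for ord
  define L where "L = {ord. linear_order_on V ord}"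
  define R where "R = (\<lambda>ord. Max (f ord ` I)) ` L"
  have "{S. independent_set V w S} \<subseteq> Pow V" by (auto simp: independent_set_def)
  then have finI: "finite I" using fin unfolding I_def
    by (meson finite_Pow_iff finite_SigmaI finite_subset)
  have "independent_set V w {}" by (simp add: independent_set_def)
  then have neI: "I \<noteq> {}" using assms(2) by (auto simp: I_def)
  have "ord \<subseteq> V \<times> V" if "linear_order_on V ord" for ord
    using that by (auto simp: order_on_defs)
  then have "L \<subseteq> Pow (V \<times> V)" by (auto simp: L_def)
  then have finL: "finite L" using fin by (meson finite_Pow_iff finite_SigmaI finite_subset)
  obtain r0 where "well_order_on V r0" using well_order_on by blast
  then have neL: "L \<noteq> {}" by (auto simp: L_def well_order_on_def)
  have io: "inductive_order V w ord r \<longleftrightarrow> ord \<in> L \<and> Max (f ord ` I) \<le> r" for ord r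
    using finI neI by (auto simp: inductive_order_def L_def I_def f_def)
  have finR: "finite R" and neR: "R \<noteq> {}" using finL neL by (auto simp: R_def)
  obtain o1 where o1: "o1 \<in> L" "Min R = Max (f o1 ` I)"
    using Min_in[OF finR neR] by (auto simp: R_def)
  have least: "Min R \<le> r" if "inductive_order V w ord r" for ord r
  proof -
    have "Max (f ord ` I) \<in> R" and "Max (f ord ` I) \<le> r"
      using that by (auto simp: io R_def)
    then show ?thesis using finR Min_le order_trans by blast
  qed
  have wit: "inductive_order V w o1 (Min R)" using o1 by (simp add: io)
  have eq: "inductive_independence_number V w = Min R"
    unfolding inductive_independence_number_def
    by (rule Least_equality) (use wit least in blast)+
  show "\<exists>ord. inductive_order V w ord (inductive_independence_number V w)"
    using wit eq by auto
  show "inductive_order V w ord r \<Longrightarrow> inductive_independence_number V w \<le> r"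
    using least eq by auto
qed

text \<open>\<^term>\<open>D\<close> is the joint law of the pair of random sets (input set, sample set). The last
  conjunct is the standing assumption that every node occurs in at least one of the two.\<close>

definition graph_sampling_model :: "'a set \<Rightarrow> real \<Rightarrow> ('a set \<times> 'a set) pmf \<Rightarrow> bool" where
  "graph_sampling_model V c D \<longleftrightarrow>
     (\<forall>(VI, VS) \<in> set_pmf D. VI \<subseteq> V \<and> VS \<subseteq> V) \<and>
     prob_space.indep_vars (measure_pmf D) (\<lambda>_. count_space UNIV)
       (\<lambda>v (VI, VS). (v \<in> VI, v \<in> VS)) V \<and>
     (\<forall>v\<in>V.
        1 / c * measure_pmf.prob D {(VI, VS). v \<in> VS} \<le> measure_pmf.prob D {(VI, VS). v \<in> VI} \<and>
        measure_pmf.prob D {(VI, VS). v \<in> VI} \<le> c * measure_pmf.prob D {(VI, VS). v \<in> VS}) \<and>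
     (\<forall>v\<in>V. measure_pmf.prob D {(VI, VS). v \<notin> VS \<and> v \<notin> VI} = 0)"

definition n_tilde :: "real \<Rightarrow> 'a set \<Rightarrow> real" where
  "n_tilde c VS = (c + 2) * real (card VS)"

definition tau :: "real \<Rightarrow> real \<Rightarrow> real \<Rightarrow> real" where
  "tau \<rho> c m = (3 * (1 + c) ^ 3 + c) / c * (2 * \<rho> * of_int \<lceil>log 2 m\<rceil> + 1)"

definition increasing_list :: "'a rel \<Rightarrow> 'a set \<Rightarrow> 'a list" where
  "increasing_list ord S = (THE xs. xs \<in> permutations_of_set S \<and> sorted_wrt (prec ord) xs)"

definition sample_greedy :: "('a \<Rightarrow> 'a \<Rightarrow> real) \<Rightarrow> 'a rel \<Rightarrow> 'a set \<Rightarrow> 'a set" where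
  "sample_greedy w ord VS =
     fold (\<lambda>v M\<^sub>1. if (\<Sum>u\<in>M\<^sub>1. wbar w u v) < 1 then insert v M\<^sub>1 else M\<^sub>1)
       (increasing_list ord VS) {}"

text \<open>Processing the arrival of \<^term>\<open>v\<close> in state \<open>(M\<^sub>2, M\<^sub>3, M\<^sub>4)\<close>, where \<^term>\<open>B v\<close> is the outcome
  of the coin flipped for \<^term>\<open>v\<close> and \<^term>\<open>\<theta>\<close> is the conflict threshold.\<close>

definition arrival_step ::
  "('a \<Rightarrow> 'a \<Rightarrow> real) \<Rightarrow> 'a rel \<Rightarrow> 'a set \<Rightarrow> real \<Rightarrow> ('a \<Rightarrow> bool) \<Rightarrow>
   'a \<Rightarrow> 'a set \<times> 'a set \<times> 'a set \<Rightarrow> 'a set \<times> 'a set \<times> 'a set" where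
  "arrival_step w ord M\<^sub>1 \<theta> B v = (\<lambda>(M\<^sub>2, M\<^sub>3, M\<^sub>4).
     if (\<Sum>u\<in>{u\<in>M\<^sub>1. prec ord u v}. wbar w u v) < 1 then
       if B v then
         (insert v M\<^sub>2, insert v M\<^sub>3,
          if \<exists>u\<in>M\<^sub>3. wbar w u v \<ge> \<theta> then M\<^sub>4 else insert v M\<^sub>4)
       else (insert v M\<^sub>2, M\<^sub>3, M\<^sub>4)
     else (M\<^sub>2, M\<^sub>3, M\<^sub>4))"

text \<open>If the sample set is empty then \<^term>\<open>n_tilde c VS = 0\<close> and \<^term>\<open>log 2 0 = (0::real)\<close>, so
  the threshold is 0 and only the first node of \<open>M\<^sub>3\<close> is accepted. In all other cases
  \<^term>\<open>n_tilde c VS \<ge> 3\<close> and the threshold is positive.\<close>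

definition output_set ::
  "('a \<Rightarrow> 'a \<Rightarrow> real) \<Rightarrow> 'a rel \<Rightarrow> real \<Rightarrow> 'a set \<Rightarrow> 'a list \<Rightarrow> ('a \<Rightarrow> bool) \<Rightarrow> 'a set" where
  "output_set w ord c VS xs B =
     snd (snd (fold
       (arrival_step w ord (sample_greedy w ord VS) (1 / (4 * exp 1 * log 2 (n_tilde c VS))) B)
       xs ({}, {}, {})))"

text \<open>The law of \<open>M\<^sub>4\<close>. The probability \<^term>\<open>q VS\<close> may depend on the sample set, as its bound
  does. The arrival order \<^term>\<open>arrival VI VS B\<close> of the nodes of \<^term>\<open>VI\<close> is adversarial and may
  depend on all random outcomes, which covers oblivious as well as adaptive adversaries.\<close>

definition output_pmf ::
  "('a \<Rightarrow> 'a \<Rightarrow> real) \<Rightarrow> 'a rel \<Rightarrow> real \<Rightarrow> ('a set \<times> 'a set) pmf \<Rightarrow> ('a set \<Rightarrow> real) \<Rightarrow>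
   ('a set \<Rightarrow> 'a set \<Rightarrow> ('a \<Rightarrow> bool) \<Rightarrow> 'a list) \<Rightarrow> 'a set pmf" where
  "output_pmf w ord c D q arrival =
     do {
       (VI, VS) \<leftarrow> D;
       B \<leftarrow> Pi_pmf VI False (\<lambda>_. bernoulli_pmf (q VS));
       return_pmf (output_set w ord c VS (arrival VI VS B) B)
     }"

end

theory Submission
  imports Defs
begin

text \<open>
  Whether a node passes the test against \<open>M\<^sub>1\<close> depends only on the sample status of smaller nodes.
  Call such nodes candidates: \<open>M\<^sub>1\<close> and \<open>M\<^sub>2\<close> consist of the candidates in the sample and in the
  input set. If the weighted degree of every candidate towards all candidates is at most \<open>\<tau>\<close>,
  then thinning by \<open>q\<close> makes the expected degree at most \<open>1 / (2e)\<close>; the pairwise weights inside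
  \<open>M\<^sub>4\<close> are below \<open>1 / (4e log n~)\<close>, so a Chernoff bound makes a fixed node violate feasibility with
  probability at most \<open>n~ ^ (-4e)\<close>.

  The degree bound holds trivially if \<open>n \<le> 12 (1 + c)\<^sup>2\<close>, because no weight exceeds \<open>\<rho>\<close>. Otherwise
  each candidate is sampled with probability at least \<open>1 / (1 + c)\<close> given the past, and an
  exponential supermartingale compares the degree towards all candidates with the degree towards
  \<open>M\<^sub>1\<close>, up to \<open>O(\<rho> log n)\<close>. The latter is below 1 towards smaller nodes, and \<open>O(\<rho> log n)\<close> towards
  larger ones since \<open>M\<^sub>1\<close> splits into \<open>O(log n)\<close> independent sets. The same supermartingale shows
  \<open>n~ \<ge> sqrt n\<close>. An empty sample is harmless: then the threshold is 0 and \<open>M\<^sub>4\<close> has at most one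
  element.
\<close>

section \<open>Greedy selection along a linear order\<close>

lemma prec_in_carrier:
  assumes "linear_order_on V ord" "prec ord u v"
  shows "u \<in> V" "v \<in> V"
  using assms by (auto simp: order_on_defs prec_def)

lemma prec_trans:
  assumes "linear_order_on V ord" "prec ord u v" "prec ord v x"
  shows "prec ord u x"
  using assms by (auto simp: order_on_defs prec_def trans_def antisym_def)

lemma prec_asym:
  assumes "linear_order_on V ord" "prec ord u v"
  shows "\<not> prec ord v u"
  using assms by (auto simp: order_on_defs prec_def antisym_def)

lemma prec_total:
  assumes "linear_order_on V ord" "u \<in> V" "v \<in> V" "u \<noteq> v"
  shows "prec ord u v \<or> prec ord v u"
  using assms by (auto simp: order_on_defs prec_def total_on_def)

lemma finite_prec_max:
  assumes ord: "linear_order_on V ord" and "finite A" "A \<noteq> {}" "A \<subseteq> V"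
  shows "\<exists>m\<in>A. \<forall>u\<in>A - {m}. prec ord u m"
  using assms(2-)
proof (induction A rule: finite_ne_induct)
  case (insert x F)
  then obtain m where m: "m \<in> F" "\<forall>u\<in>F - {m}. prec ord u m" by auto
  show ?case
  proof (cases "prec ord x m")
    case True
    then show ?thesis using m by auto
  next
    case False
    then have "prec ord m x" using prec_total[OF ord] m insert by blast
    then have "\<forall>u\<in>insert x F - {x}. prec ord u x" using m prec_trans[OF ord] by auto
    then show ?thesis by blast
  qed
qed auto

lemma prec_sorted_list_unique:
  assumes ord: "linear_order_on V ord"
    and "sorted_wrt (prec ord) xs" "sorted_wrt (prec ord) ys" "set xs = set ys"
  shows "xs = ys"
  using assms(2-)
proof (induction xs arbitrary: ys)
  case (Cons x xs)
  then obtain y ys' where ys: "ys = y # ys'" by (cases ys) auto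
  have irrefl: "\<not> prec ord u u" for u by (simp add: prec_def)
  have "x = y"
  proof (rule ccontr)
    assume "x \<noteq> y"
    then have "x \<in> set ys'" "y \<in> set xs" using Cons.prems ys by auto
    then show False using Cons.prems ys prec_asym[OF ord] by auto
  qed
  moreover have "x \<notin> set xs" "y \<notin> set ys'" using Cons.prems ys irrefl by auto
  ultimately have "set xs = set ys'" using Cons.prems ys by auto
  then show ?case using Cons ys \<open>x = y\<close> by auto
qed auto

lemma prec_sorted_list_exists:
  assumes ord: "linear_order_on V ord" and "finite S" "S \<subseteq> V"
  shows "\<exists>xs. xs \<in> permutations_of_set S \<and> sorted_wrt (prec ord) xs"
  using assms(2-)
proof (induction S rule: finite_psubset_induct)
  case (psubset S)
  show ?case
  proof (cases "S = {}")
    case False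
    then obtain m where m: "m \<in> S" "\<forall>u\<in>S - {m}. prec ord u m"
      using finite_prec_max[OF ord psubset.hyps] psubset.prems by auto
    obtain xs where xs: "xs \<in> permutations_of_set (S - {m})" "sorted_wrt (prec ord) xs"
      using psubset.IH[of "S - {m}"] m psubset.prems by auto
    then have "xs @ [m] \<in> permutations_of_set S" "sorted_wrt (prec ord) (xs @ [m])"
      using m by (auto simp: permutations_of_set_def sorted_wrt_append)
    then show ?thesis by blast
  qed auto
qed

text \<open>Existence and uniqueness of the sorted enumeration discharge the definite description in
  \<open>increasing_list\<close>.\<close>

lemma increasing_list_sorted:
  assumes ord: "linear_order_on V ord" and "finite S" "S \<subseteq> V"
  shows "set (increasing_list ord S) = S" "sorted_wrt (prec ord) (increasing_list ord S)"
proof -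
  have "\<exists>!xs. xs \<in> permutations_of_set S \<and> sorted_wrt (prec ord) xs"
    using prec_sorted_list_exists[OF assms] prec_sorted_list_unique[OF ord]
    by (metis permutations_of_setD(1))
  from theI'[OF this] show "set (increasing_list ord S) = S"
      "sorted_wrt (prec ord) (increasing_list ord S)"
    unfolding increasing_list_def by (auto dest: permutations_of_setD)
qed

text \<open>When \<open>v\<close> is processed, the current set consists of the selected nodes below
  \<open>v\<close>, and everything inserted later lies above \<open>v\<close>. So the fold can be
  replaced by a fixed-point equation in the final set, the only form in which \<open>M1\<close> is
  used later.\<close>

lemma mem_sample_greedy_iff:
  assumes ord: "linear_order_on V ord" and "finite S" "S \<subseteq> V"
  shows "v \<in> sample_greedy w ord S \<longleftrightarrow>
    v \<in> S \<and> (\<Sum>u\<in>{u\<in>sample_greedy w ord S. prec ord u v}. wbar w u v) < 1"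
proof -
  define step where
    "step v M = (if (\<Sum>u\<in>M. wbar w u v) < 1 then insert v M else M)" for v M
  \<comment> \<open>The invariant is kept for every sorted list and proved by appending: the new
    node is above all others, so no earlier backward sum changes.\<close>
  have "fold step xs {} \<subseteq> set xs \<and> (\<forall>v\<in>set xs. v \<in> fold step xs {} \<longleftrightarrow>
      (\<Sum>u\<in>{u\<in>fold step xs {}. prec ord u v}. wbar w u v) < 1)"
    if "sorted_wrt (prec ord) xs" for xs
    using that
  proof (induction xs rule: rev_induct)
    case (snoc x xs)
    define M where "M = fold step xs {}"
    have srt: "sorted_wrt (prec ord) xs" and below: "\<forall>u\<in>set xs. prec ord u x"
      using snoc.prems by (auto simp: sorted_wrt_append)
    have sub: "M \<subseteq> set xs" and IH: "\<And>v. v \<in> set xs \<Longrightarrow>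
        v \<in> M \<longleftrightarrow> (\<Sum>u\<in>{u\<in>M. prec ord u v}. wbar w u v) < 1"
      using snoc.IH[OF srt] by (auto simp: M_def)
    have irrefl: "\<not> prec ord u u" for u by (simp add: prec_def)
    have x: "x \<notin> set xs" using below irrefl by blast
    have fold: "fold step (xs @ [x]) {} = step x M" by (simp add: M_def)
    have "{u \<in> step x M. prec ord u v} = {u \<in> M. prec ord u v}" if "v \<in> set xs" for v
      using below that prec_asym[OF ord] by (auto simp: step_def)
    moreover have "{u \<in> step x M. prec ord u x} = M"
      using below sub irrefl by (auto simp: step_def)
    moreover have "v \<in> step x M \<longleftrightarrow> v \<in> M" if "v \<in> set xs" for v
      using that x by (auto simp: step_def)
    moreover have "x \<in> step x M \<longleftrightarrow> (\<Sum>u\<in>M. wbar w u x) < 1"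
      using x sub by (auto simp: step_def)
    ultimately show ?case using IH sub unfolding fold by (auto simp: step_def)
  qed auto
  from this[OF increasing_list_sorted(2)[OF assms]] increasing_list_sorted(1)[OF assms]
  show ?thesis unfolding sample_greedy_def step_def by blast
qed

text \<open>By the fixed-point equation, membership of a node is decided by its own sample status
  and by the selected nodes below it; recursion on the number of predecessors does the rest. This
  makes candidacy adapted to the order, as the supermartingale argument requires.\<close>

lemma sample_greedy_below_cong:
  assumes ord: "linear_order_on V ord" and "finite V" "S \<subseteq> V" "S' \<subseteq> V"
    and "{u\<in>S. prec ord u v} = {u\<in>S'. prec ord u v}"
  shows "{u\<in>sample_greedy w ord S. prec ord u v} = {u\<in>sample_greedy w ord S'. prec ord u v}"
  using assms(5)
proof (induction "card {u. prec ord u v}" arbitrary: v rule: less_induct)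
  case less
  have fin: "finite S" "finite S'" using assms(2-4) finite_subset by auto
  have below: "finite {u. prec ord u v}"
    by (rule finite_subset[OF _ assms(2)]) (auto dest: prec_in_carrier[OF ord])
  have "u \<in> sample_greedy w ord S \<longleftrightarrow> u \<in> sample_greedy w ord S'" if u: "prec ord u v" for u
  proof -
    have "{x. prec ord x u} \<subseteq> {x. prec ord x v}"
      using prec_trans[OF ord _ u] by blast
    moreover have "u \<in> {x. prec ord x v}" "u \<notin> {x. prec ord x u}"
      using u by (auto simp: prec_def)
    ultimately have "{x. prec ord x u} \<subset> {x. prec ord x v}" by blast
    then have "card {x. prec ord x u} < card {x. prec ord x v}"
      by (rule psubset_card_mono[OF below])
    moreover have "{x\<in>S. prec ord x u} = {x\<in>S'. prec ord x u}"
      using less.prems prec_trans[OF ord _ u] by blast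
    ultimately have "{x\<in>sample_greedy w ord S. prec ord x u} =
        {x\<in>sample_greedy w ord S'. prec ord x u}"
      by (rule less.hyps)
    moreover have "u \<in> S \<longleftrightarrow> u \<in> S'" using less.prems u by blast
    ultimately show ?thesis
      unfolding mem_sample_greedy_iff[OF ord fin(1) assms(3), of u w]
        mem_sample_greedy_iff[OF ord fin(2) assms(4), of u w] by simp
  qed
  then show ?case by auto
qed

text \<open>A node enters \<open>M4\<close> only after a test against all of \<open>M3\<close>,
  which contains \<open>M4\<close>; with symmetry of \<open>wbar\<close> this covers both orders of
  a pair. Nothing depends on the arrival order, so an adversary has no influence on these two
  properties.\<close>

lemma output_set_pairwise:
  defines "\<theta> \<equiv> \<lambda>c VS. 1 / (4 * exp 1 * log 2 (n_tilde c VS))"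
  shows "output_set w ord c VS xs B \<subseteq> {v \<in> set xs. B v \<and>
      (\<Sum>u\<in>{u\<in>sample_greedy w ord VS. prec ord u v}. wbar w u v) < 1}"
    and "u \<in> output_set w ord c VS xs B \<Longrightarrow> v \<in> output_set w ord c VS xs B \<Longrightarrow> u \<noteq> v
      \<Longrightarrow> wbar w u v < \<theta> c VS"
proof -
  define R where "R = (\<lambda>xs. fold (arrival_step w ord (sample_greedy w ord VS) (\<theta> c VS) B) xs
    ({}, {}, {}))"
  define C where "C = {v. B v \<and>
      (\<Sum>u\<in>{u\<in>sample_greedy w ord VS. prec ord u v}. wbar w u v) < 1}"
  have wbar_comm: "wbar w u v = wbar w v u" for u v by (simp add: wbar_def)
  have "snd (snd (R xs)) \<subseteq> fst (snd (R xs)) \<and> fst (snd (R xs)) \<subseteq> set xs \<inter> C \<and>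
      (\<forall>u\<in>snd (snd (R xs)). \<forall>v\<in>snd (snd (R xs)). u \<noteq> v \<longrightarrow> wbar w u v < \<theta> c VS)"
  proof (induction xs rule: rev_induct)
    case Nil
    then show ?case by (simp add: R_def)
  next
    case (snoc x xs)
    obtain M2 M3 M4 where R: "R xs = (M2, M3, M4)" by (cases "R xs") auto
    have R': "R (xs @ [x]) = arrival_step w ord (sample_greedy w ord VS) (\<theta> c VS) B x (M2, M3, M4)"
      using R by (simp add: R_def)
    have IH: "M4 \<subseteq> M3" "M3 \<subseteq> set xs \<inter> C"
      "\<And>u v. u \<in> M4 \<Longrightarrow> v \<in> M4 \<Longrightarrow> u \<noteq> v \<Longrightarrow> wbar w u v < \<theta> c VS"
      using snoc R by auto
    show ?case
    proof (cases "x \<in> C")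
      case False
      then have "snd (R (xs @ [x])) = (M3, M4)"
        by (simp add: R' arrival_step_def C_def)
      then show ?thesis using IH by auto
    next
      case x: True
      define M4' where "M4' = (if \<exists>u\<in>M3. wbar w u x \<ge> \<theta> c VS then M4 else insert x M4)"
      have "snd (R (xs @ [x])) = (insert x M3, M4')"
        using x by (simp add: R' arrival_step_def C_def M4'_def)
      moreover have "wbar w u v < \<theta> c VS" if "u \<in> M4'" "v \<in> M4'" "u \<noteq> v" for u v
        using that IH(1) IH(3)[of u v] wbar_comm[of u v]
        by (force simp: M4'_def not_le split: if_splits)
      moreover have "M4' \<subseteq> insert x M3" using IH(1) by (auto simp: M4'_def)
      ultimately show ?thesis using IH(2) x by auto
    qed
  qed
  then show "output_set w ord c VS xs B \<subseteq> {v \<in> set xs. B v \<and>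
      (\<Sum>u\<in>{u\<in>sample_greedy w ord VS. prec ord u v}. wbar w u v) < 1}"
    and "u \<in> output_set w ord c VS xs B \<Longrightarrow> v \<in> output_set w ord c VS xs B \<Longrightarrow> u \<noteq> v
      \<Longrightarrow> wbar w u v < \<theta> c VS"
    by (auto simp: output_set_def R_def C_def \<theta>_def)
qed

section \<open>Forward sums and independent sets\<close>

text \<open>Every local minimum of the total weight inside the two parts works.\<close>

lemma halving_partition:
  fixes s :: "'a \<Rightarrow> 'a \<Rightarrow> real"
  assumes "finite H" and sym: "\<And>x y. s x y = s y x" and diag: "\<And>x. x \<in> H \<Longrightarrow> s x x = 0"
  obtains A where "A \<subseteq> H"
    and "\<And>x. x \<in> A \<Longrightarrow> 2 * (\<Sum>y\<in>A. s x y) \<le> (\<Sum>y\<in>H. s x y)"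
    and "\<And>x. x \<in> H - A \<Longrightarrow> 2 * (\<Sum>y\<in>H - A. s x y) \<le> (\<Sum>y\<in>H. s x y)"
proof -
  define inner where "inner A = (\<Sum>x\<in>A. \<Sum>y\<in>A. s x y)" for A
  define f where "f A = inner A + inner (H - A)" for A
  have ins: "inner (insert x A) = inner A + 2 * (\<Sum>y\<in>A. s x y)"
    if "x \<in> H" "x \<notin> A" "A \<subseteq> H" for x A
  proof -
    have "finite A" using that assms(1) finite_subset by blast
    moreover have "(\<Sum>y\<in>A. s y x) = (\<Sum>y\<in>A. s x y)" by (rule sum.cong[OF refl]) (rule sym)
    ultimately show ?thesis
      using that diag[of x] by (simp add: inner_def sum.distrib)
  qed
  \<comment> \<open>Moving \<open>x\<close> across changes the inner weight by twice the difference
    of its weights to the two parts. At a minimum, \<open>x\<close> thus has at most half of its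
    total weight inside its own part.\<close>
  have flip: "f (insert x A) = f A + 2 * (\<Sum>y\<in>A. s x y) - 2 * (\<Sum>y\<in>H - A. s x y)"
    if x: "x \<in> H" "x \<notin> A" "A \<subseteq> H" for x A
  proof -
    have eq: "H - A = insert x (H - insert x A)" using x by auto
    have "inner (H - A) = inner (H - insert x A) + 2 * (\<Sum>y\<in>H - insert x A. s x y)"
      by (subst eq, rule ins) (use x in auto)
    moreover have "(\<Sum>y\<in>H - A. s x y) = (\<Sum>y\<in>H - insert x A. s x y)"
      by (subst eq) (use x assms(1) diag in simp)
    ultimately show ?thesis using ins[OF x] by (simp add: f_def)
  qed
  have "finite (f ` Pow H)" "f ` Pow H \<noteq> {}" using assms(1) by auto
  then have "Min (f ` Pow H) \<in> f ` Pow H" by (rule Min_in)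
  then obtain A where A: "A \<subseteq> H" and "Min (f ` Pow H) = f A" by blast
  then have min: "f A \<le> f B" if "B \<subseteq> H" for B
    using Min_le[OF \<open>finite (f ` Pow H)\<close>, of "f B"] that by auto
  have split: "(\<Sum>y\<in>H. s x y) = (\<Sum>y\<in>A. s x y) + (\<Sum>y\<in>H - A. s x y)" for x
    using sum.subset_diff[OF A assms(1)] by (simp add: add.commute)
  show ?thesis
  proof
    show "A \<subseteq> H" by fact
    show "2 * (\<Sum>y\<in>H - A. s x y) \<le> (\<Sum>y\<in>H. s x y)" if "x \<in> H - A" for x
      using flip[of x A] min[of "insert x A"] that A split[of x] by auto
    \<comment> \<open>For a node of \<open>A\<close> the move goes the other way, so
      \<open>flip\<close> is applied to \<open>A - {x}\<close>.\<close>
    show "2 * (\<Sum>y\<in>A. s x y) \<le> (\<Sum>y\<in>H. s x y)" if x: "x \<in> A" for x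
    proof -
      have eqA: "insert x (A - {x}) = A" and eqH: "H - (A - {x}) = insert x (H - A)"
        using x A by auto
      have "finite A" by (rule finite_subset[OF A assms(1)])
      have "f A = f (A - {x}) + 2 * (\<Sum>y\<in>A - {x}. s x y) - 2 * (\<Sum>y\<in>H - (A - {x}). s x y)"
        using flip[of x "A - {x}"] x A unfolding eqA by auto
      moreover have "f A \<le> f (A - {x})" by (rule min) (use A in auto)
      moreover have "(\<Sum>y\<in>A - {x}. s x y) = (\<Sum>y\<in>A. s x y)"
        using sum.remove[OF \<open>finite A\<close> x, of "s x"] diag[of x] x A by auto
      moreover have "(\<Sum>y\<in>H - (A - {x}). s x y) = (\<Sum>y\<in>H - A. s x y)"
        unfolding eqH using x A assms(1) diag[of x] by auto
      ultimately show ?thesis using split[of x] by simp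
    qed
  qed
qed

section \<open>Degrees under an inductive order\<close>

context
  fixes V :: "'a set" and w :: "'a \<Rightarrow> 'a \<Rightarrow> real" and ord :: "'a rel" and \<rho> :: real
  assumes graph: "conflict_graph V w" and ind: "inductive_order V w ord \<rho>"
begin

lemma wbar_nonneg: "u \<in> V \<Longrightarrow> v \<in> V \<Longrightarrow> 0 \<le> wbar w u v"
  using graph by (auto simp: conflict_graph_def wbar_def)

lemma wbar_diag: "v \<in> V \<Longrightarrow> wbar w v v = 0"
  using graph by (auto simp: conflict_graph_def wbar_def)

text \<open>The empty set is independent and has sum 0; a node is required to instantiate the
  bound.\<close>

lemma inductive_order_bound_nonneg: "v \<in> V \<Longrightarrow> 0 \<le> \<rho>"
  using ind unfolding inductive_order_def
  by (metis (no_types, lifting) empty_subsetI independent_set_def ball_empty empty_iff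
      empty_Collect_eq sum.empty)

text \<open>A singleton is independent, so applying the order bound to the larger endpoint, seen
  from the smaller one, isolates a single weight. Dividing by \<open>\<rho>\<close> therefore
  normalises weights to the unit interval.\<close>

lemma wbar_le_inductive_bound:
  assumes "u \<in> V" "v \<in> V"
  shows "wbar w u v \<le> \<rho>"
proof -
  have *: "wbar w x y \<le> \<rho>" if "x \<in> V" "prec ord y x" for x y
  proof -
    have "independent_set V w {x}" using that graph
      by (auto simp: independent_set_def conflict_graph_def)
    moreover have "y \<in> V" using that ind by (auto simp: inductive_order_def order_on_defs prec_def)
    ultimately have "(\<Sum>u\<in>{u\<in>{x}. prec ord y u}. wbar w u y) \<le> \<rho>"
      using ind unfolding inductive_order_def by blast
    moreover have "{u\<in>{x}. prec ord y u} = {x}" using that by auto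
    ultimately show ?thesis by simp
  qed
  consider "u = v" | "prec ord u v" | "prec ord v u"
    using assms ind by (auto simp: inductive_order_def order_on_defs prec_def total_on_def)
  then show ?thesis
  proof cases
    case 1
    then show ?thesis using inductive_order_bound_nonneg wbar_diag assms by auto
  next
    case 2
    then show ?thesis using *[of v u] assms by (simp add: wbar_def add.commute)
  next
    case 3
    then show ?thesis using *[of u v] assms by simp
  qed
qed

text \<open>Halving twice cuts \<open>H\<close> into four sets with inner degrees below 1. Each is
  independent, since \<open>w\<close> is dominated by \<open>wbar\<close>, and contributes at most
  \<open>\<rho>\<close>.\<close>

lemma forward_sum_le_4:
  assumes "H \<subseteq> V" "v \<in> V" and "\<And>x. x \<in> H \<Longrightarrow> (\<Sum>y\<in>H. wbar w x y) < 4"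
  shows "(\<Sum>u\<in>{u\<in>H. prec ord v u}. wbar w u v) \<le> 4 * \<rho>"
proof -
  define F where "F A = (\<Sum>u\<in>{u\<in>A. prec ord v u}. wbar w u v)" for A
  have finV: "finite V" using graph by (simp add: conflict_graph_def)
  have sym: "wbar w x y = wbar w y x" for x y by (simp add: wbar_def)
  have add: "F A = F B + F (A - B)" if "B \<subseteq> A" "A \<subseteq> V" for A B
  proof -
    have "finite A" using that finV finite_subset by blast
    moreover have "{u\<in>A. prec ord v u} - {u\<in>B. prec ord v u} = {u\<in>A - B. prec ord v u}" by auto
    ultimately show ?thesis
      using sum.subset_diff[of "{u\<in>B. prec ord v u}" "{u\<in>A. prec ord v u}" "\<lambda>u. wbar w u v"] that
      unfolding F_def by (simp add: add.commute Collect_mono_iff subset_iff)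
  qed
  have one: "F A \<le> \<rho>" if A: "A \<subseteq> V" "\<And>x. x \<in> A \<Longrightarrow> (\<Sum>y\<in>A. wbar w x y) < 1" for A
  proof -
    have "(\<Sum>u\<in>A. w u x) < 1" if "x \<in> A" for x
    proof -
      have "(\<Sum>u\<in>A. w u x) \<le> (\<Sum>u\<in>A. wbar w x u)"
      proof (rule sum_mono)
        fix u assume "u \<in> A"
        then have "0 \<le> w x u" using graph A(1) that unfolding conflict_graph_def by blast
        then show "w u x \<le> wbar w x u" by (simp add: wbar_def)
      qed
      then show ?thesis using A(2)[OF that] by simp
    qed
    then have "independent_set V w A" using A by (auto simp: independent_set_def)
    then show ?thesis using ind assms(2) by (auto simp: inductive_order_def F_def)
  qed
  have two: "F A \<le> 2 * \<rho>" if A: "A \<subseteq> V" "\<And>x. x \<in> A \<Longrightarrow> (\<Sum>y\<in>A. wbar w x y) < 2" for A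
  proof -
    have "finite A" using A finV finite_subset by blast
    then obtain B where B: "B \<subseteq> A"
      "\<And>x. x \<in> B \<Longrightarrow> 2 * (\<Sum>y\<in>B. wbar w x y) \<le> (\<Sum>y\<in>A. wbar w x y)"
      "\<And>x. x \<in> A - B \<Longrightarrow> 2 * (\<Sum>y\<in>A - B. wbar w x y) \<le> (\<Sum>y\<in>A. wbar w x y)"
      using halving_partition[of A "wbar w"] sym wbar_diag A by (metis subsetD)
    have "F B \<le> \<rho>" by (rule one) (use B A in \<open>fastforce+\<close>)
    moreover have "F (A - B) \<le> \<rho>" by (rule one) (use B A in \<open>fastforce+\<close>)
    ultimately show ?thesis using add[OF B(1) A(1)] by simp
  qed
  have "finite H" using assms finV finite_subset by blast
  then obtain B where B: "B \<subseteq> H"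
    "\<And>x. x \<in> B \<Longrightarrow> 2 * (\<Sum>y\<in>B. wbar w x y) \<le> (\<Sum>y\<in>H. wbar w x y)"
    "\<And>x. x \<in> H - B \<Longrightarrow> 2 * (\<Sum>y\<in>H - B. wbar w x y) \<le> (\<Sum>y\<in>H. wbar w x y)"
    using halving_partition[of H "wbar w"] sym wbar_diag assms by (metis subsetD)
  have "F B \<le> 2 * \<rho>" by (rule two) (use B assms in \<open>fastforce+\<close>)
  moreover have "F (H - B) \<le> 2 * \<rho>" by (rule two) (use B assms in \<open>fastforce+\<close>)
  ultimately show ?thesis using add[OF B(1) assms(1)] by (simp add: F_def)
qed

text \<open>Handshake identity: an unordered pair occurs in two rows on the left, but only at its
  larger endpoint on the right.\<close>

lemma sum_wbar_both_sides:
  assumes "M \<subseteq> V"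
  shows "(\<Sum>x\<in>M. \<Sum>y\<in>M. wbar w x y) = 2 * (\<Sum>x\<in>M. \<Sum>y\<in>{y\<in>M. prec ord y x}. wbar w y x)"
proof -
  have finM: "finite M" using assms graph finite_subset by (auto simp: conflict_graph_def)
  have lin: "linear_order_on V ord" using ind by (simp add: inductive_order_def)
  have row: "(\<Sum>y\<in>M. wbar w x y) = (\<Sum>y\<in>M. if prec ord y x then wbar w y x else 0)
      + (\<Sum>y\<in>M. if prec ord x y then wbar w x y else 0)" if x: "x \<in> M" for x
    unfolding sum.distrib[symmetric]
  proof (rule sum.cong)
    fix y assume y: "y \<in> M"
    consider "x = y" | "prec ord x y" "\<not> prec ord y x" | "prec ord y x" "\<not> prec ord x y"
      using prec_total[OF lin, of x y] prec_asym[OF lin, of x y] prec_asym[OF lin, of y x] x y assms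
      by blast
    then show "wbar w x y = (if prec ord y x then wbar w y x else 0)
        + (if prec ord x y then wbar w x y else 0)"
    proof cases
      case 1
      then show ?thesis using x assms wbar_diag[of x] by (auto simp: prec_def)
    qed (simp_all add: wbar_def)
  qed simp
  have swap: "(\<Sum>x\<in>M. \<Sum>y\<in>M. if prec ord x y then wbar w x y else 0) =
      (\<Sum>x\<in>M. \<Sum>y\<in>M. if prec ord y x then wbar w y x else 0)"
    by (rule sum.swap)
  have "(\<Sum>x\<in>M. \<Sum>y\<in>M. wbar w x y) = 2 * (\<Sum>x\<in>M. \<Sum>y\<in>M. if prec ord y x then wbar w y x else 0)"
    using row swap by (simp add: sum.distrib)
  also have "\<dots> = 2 * (\<Sum>x\<in>M. \<Sum>y\<in>{y\<in>M. prec ord y x}. wbar w y x)"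
    using finM by (simp add: sum.inter_filter)
  finally show ?thesis .
qed

text \<open>The backward sums bound the average total degree by 2, so at least half of the nodes have
  degree below 4; peel these off and repeat.\<close>

lemma forward_sum_log_bound:
  assumes "v \<in> V" "M \<subseteq> V" "card M < 2 ^ k"
    and "\<And>x. x \<in> M \<Longrightarrow> (\<Sum>y\<in>{y\<in>M. prec ord y x}. wbar w y x) < 1"
  shows "(\<Sum>u\<in>{u\<in>M. prec ord v u}. wbar w u v) \<le> 4 * \<rho> * real k"
  using assms(2-)
proof (induction k arbitrary: M)
  case 0
  moreover have "finite M" using 0 graph finite_subset by (auto simp: conflict_graph_def)
  ultimately have "M = {}" by simp
  then show ?case by simp
next
  case (Suc k)
  have finM: "finite M" using Suc graph finite_subset by (auto simp: conflict_graph_def)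
  have MV: "x \<in> V" if "x \<in> M" for x using that Suc.prems(1) by blast
  define deg where "deg x = (\<Sum>y\<in>M. wbar w x y)" for x
  define H where "H = {x\<in>M. deg x < 4}"
  have deg_nonneg: "0 \<le> deg x" if "x \<in> M" for x
    unfolding deg_def by (intro sum_nonneg wbar_nonneg MV that)
  have "4 * real (card (M - H)) = (\<Sum>x\<in>M - H. 4)" by simp
  also have "\<dots> \<le> (\<Sum>x\<in>M - H. deg x)" by (intro sum_mono) (auto simp: H_def)
  also have "\<dots> \<le> (\<Sum>x\<in>M. deg x)" using finM deg_nonneg by (intro sum_mono2) auto
  also have "\<dots> = 2 * (\<Sum>x\<in>M. \<Sum>y\<in>{y\<in>M. prec ord y x}. wbar w y x)"
    using sum_wbar_both_sides[OF Suc.prems(1)] by (simp add: deg_def)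
  also have "\<dots> \<le> 2 * (\<Sum>x\<in>M. 1)"
    by (intro mult_left_mono sum_mono less_imp_le Suc.prems(3)) auto
  finally have "2 * card (M - H) \<le> card M" by simp
  then have cardk: "card (M - H) < 2 ^ k" using Suc.prems(2) by simp
  have "(\<Sum>u\<in>{u\<in>M - H. prec ord v u}. wbar w u v) \<le> 4 * \<rho> * real k"
  proof (rule Suc.IH[OF _ cardk])
    fix x assume x: "x \<in> M - H"
    \<comment> \<open>Deleting nodes only lowers backward sums, so the remainder inherits the
      hypothesis.\<close>
    have "(\<Sum>y\<in>{y\<in>M - H. prec ord y x}. wbar w y x) \<le> (\<Sum>y\<in>{y\<in>M. prec ord y x}. wbar w y x)"
      using finM x by (intro sum_mono2) (auto intro: wbar_nonneg MV)
    then show "(\<Sum>y\<in>{y\<in>M - H. prec ord y x}. wbar w y x) < 1"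
      using Suc.prems(3)[of x] x by simp
  qed (use Suc.prems in auto)
  moreover have "(\<Sum>u\<in>{u\<in>H. prec ord v u}. wbar w u v) \<le> 4 * \<rho>"
  proof (rule forward_sum_le_4[OF _ assms(1)])
    fix x assume x: "x \<in> H"
    have "(\<Sum>y\<in>H. wbar w x y) \<le> deg x"
      unfolding deg_def using finM x
      by (intro sum_mono2) (auto simp: H_def intro: wbar_nonneg MV)
    then show "(\<Sum>y\<in>H. wbar w x y) < 4" using x by (simp add: H_def)
  qed (use Suc.prems in \<open>auto simp: H_def\<close>)
  moreover have "(\<Sum>u\<in>{u\<in>M. prec ord v u}. wbar w u v) =
      (\<Sum>u\<in>{u\<in>H. prec ord v u}. wbar w u v) + (\<Sum>u\<in>{u\<in>M - H. prec ord v u}. wbar w u v)"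
  proof -
    have eq: "{u\<in>M. prec ord v u} = {u\<in>H. prec ord v u} \<union> {u\<in>M - H. prec ord v u}"
      by (auto simp: H_def)
    show ?thesis
      unfolding eq by (rule sum.union_disjoint) (use finM in \<open>auto simp: H_def\<close>)
  qed
  ultimately show ?case by (simp add: algebra_simps)
qed

end

section \<open>Exponential moments of adapted sums\<close>

text \<open>Conditionally on the coins of the smaller nodes, each factor of the exponential has
  expectation at most 1, so the largest node can be integrated out first.\<close>

lemma nn_integral_exp_adapted_le_1:
  fixes a x p :: "'a \<Rightarrow> real" and active :: "('a \<Rightarrow> bool) \<Rightarrow> 'a \<Rightarrow> bool"
  assumes ord: "linear_order_on V ord"
    and local: "\<And>b b' v. (\<And>u. prec ord u v \<Longrightarrow> b u = b' u) \<Longrightarrow> active b v = active b' v"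
    and "finite A" "A \<subseteq> V"
    and "\<And>v. v \<in> A \<Longrightarrow> 0 \<le> p v \<and> p v \<le> 1"
    and "\<And>v. v \<in> A \<Longrightarrow> p v * exp (a v - x v) + (1 - p v) * exp (a v) \<le> 1"
  shows "(\<integral>\<^sup>+b. ennreal (exp (\<Sum>v\<in>{v\<in>A. active b v}. a v - (if b v then x v else 0)))
      \<partial>Pi_pmf A False (\<lambda>v. bernoulli_pmf (p v))) \<le> 1"
  using assms(3-)
proof (induction A rule: finite_psubset_induct)
  case (psubset A)
  show ?case
  proof (cases "A = {}")
    case False
    then obtain m where m: "m \<in> A" "\<forall>u\<in>A - {m}. prec ord u m"
      using finite_prec_max[OF ord psubset.hyps] psubset.prems by auto
    define A0 where "A0 = A - {m}"
    have A: "A = insert m A0" "m \<notin> A0" "finite A0" using m psubset.hyps by (auto simp: A0_def)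
    define Z where "Z b = (\<Sum>v\<in>{v\<in>A0. active b v}. a v - (if b v then x v else 0))" for b
    \<comment> \<open>The coin of the maximum \<open>m\<close> lies below no node of
      \<open>A\<close>, so it affects no activity, not even that of \<open>m\<close>.\<close>
    have act: "active (b(m := y)) v = active b v" if "v \<in> A" for b y v
      using m that prec_asym[OF ord] by (intro local) (auto simp: A prec_def)
    have Z: "(\<Sum>v\<in>{v\<in>A. active (b(m := y)) v}. a v - (if (b(m := y)) v then x v else 0)) =
        Z b + (if active b m then a m - (if y then x m else 0) else 0)" for b y
    proof -
      have eq: "{v\<in>A. active (b(m := y)) v} =
          {v\<in>A0. active b v} \<union> (if active b m then {m} else {})"
        using act A by auto
      have "(\<Sum>v\<in>{v\<in>A0. active b v}. a v - (if (b(m := y)) v then x v else 0)) = Z b"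
        unfolding Z_def using A by (intro sum.cong) auto
      then show ?thesis unfolding eq using A by auto
    qed
    have le1: "p m * exp (a m - x m) + (1 - p m) * exp (a m) \<le> 1" and pm: "0 \<le> p m" "p m \<le> 1"
      using psubset.prems m by auto
    have inner: "(\<integral>\<^sup>+y. ennreal (exp (Z b + (if active b m then a m - (if y then x m else 0) else 0)))
        \<partial>bernoulli_pmf (p m)) \<le> ennreal (exp (Z b))" for b
    proof -
      have "(\<integral>\<^sup>+y. ennreal (exp (Z b + (if active b m then a m - (if y then x m else 0) else 0)))
          \<partial>bernoulli_pmf (p m)) =
        ennreal (exp (Z b + (if active b m then a m - x m else 0)) * p m +
                 exp (Z b + (if active b m then a m else 0)) * (1 - p m))"
        using pm by (simp add: ennreal_mult ennreal_plus)
      \<comment> \<open>If \<open>m\<close> is inactive its factor is 1; otherwise the hypothesis on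
        \<open>p m\<close> bounds the average factor by 1.\<close>
      also have "\<dots> \<le> ennreal (exp (Z b))"
      proof (rule ennreal_leI)
        have "exp (Z b) * (p m * exp (a m - x m) + (1 - p m) * exp (a m)) \<le> exp (Z b) * 1"
          by (intro mult_left_mono le1) auto
        then show "exp (Z b + (if active b m then a m - x m else 0)) * p m +
            exp (Z b + (if active b m then a m else 0)) * (1 - p m) \<le> exp (Z b)"
          by (simp add: exp_add algebra_simps)
      qed
      finally show ?thesis .
    qed
    have "Pi_pmf A False (\<lambda>v. bernoulli_pmf (p v)) =
        map_pmf (\<lambda>(b, y). b(m := y))
          (pair_pmf (Pi_pmf A0 False (\<lambda>v. bernoulli_pmf (p v))) (bernoulli_pmf (p m)))"
      unfolding A(1) Pi_pmf_insert[OF A(3,2)]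
      by (subst pair_commute_pmf) (simp add: pmf.map_comp comp_def case_prod_unfold)
    then have "(\<integral>\<^sup>+b. ennreal (exp (\<Sum>v\<in>{v\<in>A. active b v}. a v - (if b v then x v else 0)))
        \<partial>Pi_pmf A False (\<lambda>v. bernoulli_pmf (p v))) =
      (\<integral>\<^sup>+b. \<integral>\<^sup>+y. ennreal (exp (Z b + (if active b m then a m - (if y then x m else 0) else 0)))
        \<partial>bernoulli_pmf (p m) \<partial>Pi_pmf A0 False (\<lambda>v. bernoulli_pmf (p v)))"
      by (simp only: nn_integral_map_pmf nn_integral_pair_pmf' prod.case Z)
    also have "\<dots> \<le> (\<integral>\<^sup>+b. ennreal (exp (Z b)) \<partial>Pi_pmf A0 False (\<lambda>v. bernoulli_pmf (p v)))"
      by (intro nn_integral_mono inner)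
    also have "\<dots> \<le> 1"
      unfolding Z_def by (rule psubset.IH) (use psubset.prems A in auto)
    finally show ?thesis .
  qed simp
qed

text \<open>Markov's inequality: the indicator of the event is at most
  \<open>exp (f x - t)\<close>.\<close>

lemma prob_ge_le_exp:
  assumes "(\<integral>\<^sup>+x. ennreal (exp (f x)) \<partial>measure_pmf M) \<le> 1"
  shows "measure_pmf.prob M {x. f x \<ge> t} \<le> exp (- t)"
proof -
  have "ennreal (measure_pmf.prob M {x. f x \<ge> t}) = emeasure M {x. f x \<ge> t}"
    by (simp add: measure_pmf.emeasure_eq_measure)
  also have "\<dots> = (\<integral>\<^sup>+x. indicator {x. f x \<ge> t} x \<partial>measure_pmf M)" by simp
  also have "\<dots> \<le> (\<integral>\<^sup>+x. ennreal (exp (- t)) * ennreal (exp (f x)) \<partial>measure_pmf M)"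
    by (intro nn_integral_mono)
       (auto split: split_indicator simp: ennreal_mult[symmetric] exp_add[symmetric])
  also have "\<dots> = ennreal (exp (- t)) * (\<integral>\<^sup>+x. ennreal (exp (f x)) \<partial>measure_pmf M)"
    by (rule nn_integral_cmult) simp
  also have "\<dots> \<le> ennreal (exp (- t)) * 1"
    by (intro mult_left_mono assms) simp
  finally show ?thesis by simp
qed

text \<open>On the unit interval \<open>exp (- x) \<le> 1 / (1 + x) \<le> 1 - x / 2\<close>.
  Sampling thus loses at least \<open>p * x / 2\<close> on average, which pays for the gain
  \<open>a\<close>; this is the origin of the factor \<open>2 * (1 + c)\<close>.\<close>

lemma sampling_step_le_1:
  fixes c p x :: real
  assumes "c \<ge> 1" "1 / (1 + c) \<le> p" "p \<le> 1" "0 \<le> x" "x \<le> 1"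
  defines "a \<equiv> x / (2 * (1 + c))"
  shows "p * exp (a - x) + (1 - p) * exp a \<le> 1"
proof -
  have "1 + x \<le> exp x" by (rule exp_ge_add_one_self)
  then have "exp (- x) \<le> 1 / (1 + x)" using assms by (simp add: exp_minus field_simps)
  also have "\<dots> \<le> 1 - x / 2"
    using assms mult_left_mono[of x 1 x] by (simp add: field_simps)
  finally have x: "x / 2 \<le> 1 - exp (- x)" by simp
  have "a = 1 / (1 + c) * (x / 2)" by (simp add: a_def)
  also have "\<dots> \<le> p * (1 - exp (- x))"
    by (intro mult_mono x) (use assms in \<open>auto intro: order_trans[of 0 "1 / (1 + c)"]\<close>)
  finally have "1 - p * (1 - exp (- x)) \<le> 1 + (- a)" by simp
  also have "\<dots> \<le> exp (- a)" by (rule exp_ge_add_one_self)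
  finally have "exp a * (1 - p * (1 - exp (- x))) \<le> exp a * exp (- a)" by simp
  then show ?thesis by (simp add: exp_minus exp_diff field_simps)
qed

text \<open>A Chernoff bound obtained from the adapted estimate by making every node active and
  taking both \<open>a\<close> and \<open>x\<close> nonpositive, so that upward deviations are
  controlled.\<close>

lemma bernoulli_sum_tail:
  fixes y :: "'a \<Rightarrow> real" and q \<theta> :: real
  assumes fin: "finite A" and q: "0 \<le> q" "q \<le> 1" and "\<theta> > 0"
    and y: "\<And>u. u \<in> A \<Longrightarrow> 0 \<le> y u \<and> y u \<le> \<theta>"
    and mean: "q * (\<Sum>u\<in>A. y u) \<le> 1 / (2 * exp 1)"
  shows "measure_pmf.prob (Pi_pmf A False (\<lambda>_. bernoulli_pmf q))
    {B. (\<Sum>u\<in>{u\<in>A. B u}. y u) \<ge> 1} \<le> 2 powr (- 1 / \<theta>)"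
proof -
  \<comment> \<open>The adapted estimate wants an order; as activity is constant, any one
    serves.\<close>
  obtain ord where "well_order_on A ord" using well_order_on by blast
  then have ord: "linear_order_on A ord" by (simp add: well_order_on_def)
  define a where "a u = - q * (y u / \<theta>) * (2 * exp 1 - 1)" for u
  \<comment> \<open>The exponent \<open>(1 + ln 2) / \<theta>\<close> gives base
    \<open>2 * exp 1\<close>. Of it, \<open>1 / \<theta>\<close> absorbs the compensator built from
    \<open>a\<close>, and \<open>ln 2 / \<theta>\<close> remains as the tail exponent.\<close>
  define x where "x u = - ((1 + ln 2) * (y u / \<theta>))" for u
  define f where "f B = (\<Sum>u\<in>{u\<in>A. True}. a u - (if B u then x u else 0))" for B
  have e2: "exp (1 + ln 2) = 2 * exp (1::real)" by (simp add: exp_add)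
  have step: "q * exp (a u - x u) + (1 - q) * exp (a u) \<le> 1" if "u \<in> A" for u
  proof -
    define t where "t = y u / \<theta>"
    have t: "0 \<le> t" "t \<le> 1" using y[OF that] \<open>\<theta> > 0\<close> by (auto simp: t_def)
    \<comment> \<open>Chord bound for the convex exponential between 0 and
      \<open>1 + ln 2\<close>.\<close>
    have "exp ((1 - t) *\<^sub>R 0 + t *\<^sub>R (1 + ln 2)) \<le> (1 - t) * exp 0 + t * exp (1 + ln 2 :: real)"
      by (rule convex_onD[OF exp_convex]) (use t in auto)
    then have conv: "exp (- x u) - 1 \<le> t * (2 * exp 1 - 1)"
      by (simp add: e2 x_def t_def algebra_simps)
    have "1 + q * (exp (- x u) - 1) \<le> 1 + q * (t * (2 * exp 1 - 1))"
      using mult_left_mono[OF conv q(1)] by simp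
    also have "\<dots> = 1 + (- a u)" by (simp add: a_def t_def)
    also have "\<dots> \<le> exp (- a u)" by (rule exp_ge_add_one_self)
    finally have "exp (a u) * (1 + q * (exp (- x u) - 1)) \<le> exp (a u) * exp (- a u)" by simp
    then show ?thesis by (simp add: exp_minus exp_diff field_simps)
  qed
  have "(\<integral>\<^sup>+B. ennreal (exp (f B)) \<partial>Pi_pmf A False (\<lambda>_. bernoulli_pmf q)) \<le> 1"
    unfolding f_def by (rule nn_integral_exp_adapted_le_1[OF ord]) (use fin q step in auto)
  then have tail: "measure_pmf.prob (Pi_pmf A False (\<lambda>_. bernoulli_pmf q)) {B. f B \<ge> ln 2 / \<theta>}
      \<le> exp (- (ln 2 / \<theta>))"
    by (rule prob_ge_le_exp)
  have "{B. (\<Sum>u\<in>{u\<in>A. B u}. y u) \<ge> 1} \<subseteq> {B. f B \<ge> ln 2 / \<theta>}"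
  proof safe
    fix B assume B: "(\<Sum>u\<in>{u\<in>A. B u}. y u) \<ge> 1"
    have "(\<Sum>u\<in>A. if B u then x u else 0) = (\<Sum>u\<in>{u\<in>A. B u}. x u)"
      using fin by (simp add: sum.inter_filter)
    also have "\<dots> = - ((1 + ln 2) / \<theta>) * (\<Sum>u\<in>{u\<in>A. B u}. y u)"
      by (simp add: x_def sum_distrib_left sum_negf)
    finally have "f B = - (q * (\<Sum>u\<in>A. y u)) * (2 * exp 1 - 1) / \<theta> +
        (1 + ln 2) / \<theta> * (\<Sum>u\<in>{u\<in>A. B u}. y u)"
      by (simp add: f_def sum_subtractf a_def sum_distrib_left sum_distrib_right
          sum_divide_distrib sum_negf)
    moreover have "(1 + ln 2) / \<theta> * 1 \<le> (1 + ln 2) / \<theta> * (\<Sum>u\<in>{u\<in>A. B u}. y u)"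
      using \<open>\<theta> > 0\<close> B by (intro mult_left_mono) auto
    moreover have "q * (\<Sum>u\<in>A. y u) * (2 * exp 1 - 1) / \<theta> \<le> 1 / \<theta>"
    proof -
      have e1: "(1::real) \<le> exp 1" by simp
      have "q * (\<Sum>u\<in>A. y u) * (2 * exp 1 - 1) \<le> 1 / (2 * exp 1) * (2 * exp 1 - 1)"
        using e1 by (intro mult_right_mono mean) linarith
      also have "\<dots> \<le> 1" by (simp add: field_simps)
      finally show ?thesis using \<open>\<theta> > 0\<close> by (intro divide_right_mono) auto
    qed
    ultimately show "f B \<ge> ln 2 / \<theta>" by (simp add: add_divide_distrib)
  qed
  then have "measure_pmf.prob (Pi_pmf A False (\<lambda>_. bernoulli_pmf q))
      {B. (\<Sum>u\<in>{u\<in>A. B u}. y u) \<ge> 1} \<le>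
    measure_pmf.prob (Pi_pmf A False (\<lambda>_. bernoulli_pmf q)) {B. f B \<ge> ln 2 / \<theta>}"
    by (rule measure_pmf.finite_measure_mono) simp
  also note tail
  finally show ?thesis by (simp add: powr_def)
qed

section \<open>The sample set as independent coins\<close>

context
  fixes V :: "'a set" and c :: real and D :: "('a set \<times> 'a set) pmf"
  assumes finV: "finite V" and c: "c \<ge> 1" and model: "graph_sampling_model V c D"
begin

lemma model_support: "(VI, VS) \<in> set_pmf D \<Longrightarrow> VI \<subseteq> V \<and> VS \<subseteq> V"
  using model by (auto simp: graph_sampling_model_def)

text \<open>A null event of a discrete law misses its support, so the standing assumption holds for
  every possible outcome and \<open>n\<close> is the constant \<open>card V\<close>.\<close>

lemma model_union:
  assumes "(VI, VS) \<in> set_pmf D"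
  shows "VS \<union> VI = V"
proof -
  have "v \<in> VS \<union> VI" if v: "v \<in> V" for v
  proof (rule ccontr)
    assume "v \<notin> VS \<union> VI"
    then have mem: "(VI, VS) \<in> {(VI, VS). v \<notin> VS \<and> v \<notin> VI}" by auto
    have "measure_pmf.prob D {(VI, VS). v \<notin> VS \<and> v \<notin> VI} = 0"
      using model v by (auto simp: graph_sampling_model_def)
    then have "set_pmf D \<inter> {(VI, VS). v \<notin> VS \<and> v \<notin> VI} = {}"
      by (simp add: measure_pmf_zero_iff)
    then show False using mem assms by blast
  qed
  then show ?thesis using model_support[OF assms] by blast
qed

text \<open>Union bound over the two ways a node can occur: 1 is at most \<open>1 + c\<close> times
  the sampling probability.\<close>

lemma model_sample_prob_ge:
  assumes "v \<in> V"
  shows "1 / (1 + c) \<le> measure_pmf.prob D {(VI, VS). v \<in> VS}"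
proof -
  let ?S = "{(VI, VS). v \<in> VS}" and ?I = "{(VI, VS). v \<in> VI}"
  have "1 = measure_pmf.prob D (?S \<union> ?I)"
  proof -
    have "AE x in D. x \<in> ?S \<union> ?I"
      using model_union assms by (auto simp: AE_measure_pmf_iff)
    then show ?thesis using measure_pmf.prob_eq_1[of "?S \<union> ?I" D] by auto
  qed
  also have "\<dots> \<le> measure_pmf.prob D ?S + measure_pmf.prob D ?I"
    by (rule measure_Un_le) auto
  also have "\<dots> \<le> measure_pmf.prob D ?S + c * measure_pmf.prob D ?S"
    using model assms by (auto simp: graph_sampling_model_def)
  finally show ?thesis using c by (simp add: field_simps)
qed

text \<open>Only the sample marginal is needed for the exponential moments, and it is a product law
  although the input and sample status of one node may be correlated. Point masses are compared; the
  default \<open>False\<close> matches \<open>VS \<subseteq> V\<close>.\<close>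

lemma model_sample_law:
  "map_pmf (\<lambda>(VI, VS) v. v \<in> VS) D =
    Pi_pmf V False (\<lambda>v. bernoulli_pmf (measure_pmf.prob D {(VI, VS). v \<in> VS}))" (is "_ = ?R")
proof (rule pmf_eqI)
  fix b :: "'a \<Rightarrow> bool"
  let ?X = "\<lambda>v (VI, VS). (v \<in> VI, v \<in> VS)"
  let ?A = "\<lambda>v. {VIS :: 'a set \<times> 'a set. (v \<in> snd VIS) = b v}"
  have L: "pmf (map_pmf (\<lambda>(VI, VS) v. v \<in> VS) D) b =
      measure_pmf.prob D ((\<lambda>(VI, VS) v. v \<in> VS) -` {b})"
    by (rule pmf_map)
  show "pmf (map_pmf (\<lambda>(VI, VS) v. v \<in> VS) D) b = pmf ?R b"
  proof (cases "\<forall>v. v \<notin> V \<longrightarrow> b v = False")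
    case False
    then obtain v where v: "v \<notin> V" "b v" by auto
    have "set_pmf D \<inter> (\<lambda>(VI, VS) v. v \<in> VS) -` {b} = {}"
      using v model_support by (fastforce simp: fun_eq_iff)
    then have "measure_pmf.prob D ((\<lambda>(VI, VS) v. v \<in> VS) -` {b}) = 0"
      by (simp add: measure_pmf_zero_iff)
    moreover have "pmf ?R b = 0" using v by (intro pmf_Pi_outside finV) auto
    ultimately show ?thesis using L by simp
  next
    case True
    have indep: "prob_space.indep_vars (measure_pmf D) (\<lambda>_. count_space UNIV) ?X V"
      using model by (simp add: graph_sampling_model_def)
    have bern: "measure_pmf.prob D (?A v) =
        pmf (bernoulli_pmf (measure_pmf.prob D {(VI, VS). v \<in> VS})) (b v)" for v
    proof (cases "b v")
      case True
      then show ?thesis by (simp add: case_prod_unfold)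
    next
      case False
      have "?A v = - {(VI, VS). v \<in> VS}" using False by auto
      then show ?thesis
        using False measure_pmf.prob_compl[of "{(VI, VS). v \<in> VS}" D]
        by (simp add: Compl_eq_Diff_UNIV)
    qed
    have "measure_pmf.prob D ((\<lambda>(VI, VS) v. v \<in> VS) -` {b}) =
        measure_pmf.prob D (\<Inter>v\<in>V. ?A v)"
    proof (rule measure_pmf.finite_measure_eq_AE)
      show "AE x in D. (x \<in> (\<lambda>(VI, VS) v. v \<in> VS) -` {b}) = (x \<in> (\<Inter>v\<in>V. ?A v))"
        using True model_support by (fastforce simp: AE_measure_pmf_iff fun_eq_iff)
    qed auto
    also have "\<dots> = (\<Prod>v\<in>V. measure_pmf.prob D (?A v))"
    \<comment> \<open>The product rule for independent sets is for nonempty index sets; for empty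
      \<open>V\<close> both sides are 1.\<close>
    proof (cases "V = {}")
      case False
      have "measure_pmf.prob D (\<Inter>v\<in>V. ?X v -` {z. snd z = b v} \<inter> space (measure_pmf D)) =
          (\<Prod>v\<in>V. measure_pmf.prob D (?X v -` {z. snd z = b v} \<inter> space (measure_pmf D)))"
      proof (rule prob_space.indep_setsD[OF prob_space_measure_pmf])
        show "prob_space.indep_sets (measure_pmf D)
            (\<lambda>v. {?X v -` A \<inter> space (measure_pmf D) |A. A \<in> sets (count_space UNIV)}) V"
          using indep unfolding prob_space.indep_vars_def2[OF prob_space_measure_pmf] by blast
        have "?X v -` {z. snd z = b v} \<inter> space (measure_pmf D) \<in>
            {?X v -` A \<inter> space (measure_pmf D) |A. A \<in> sets (count_space UNIV)}" for v
          unfolding sets_count_space by blast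
        then show "\<forall>v\<in>V. ?X v -` {z. snd z = b v} \<inter> space (measure_pmf D) \<in>
            {?X v -` A \<inter> space (measure_pmf D) |A. A \<in> sets (count_space UNIV)}"
          by (rule ballI)
      qed (use finV False in auto)
      moreover have "?X v -` {z. snd z = b v} \<inter> space (measure_pmf D) = ?A v" for v
        by auto
      ultimately show ?thesis by simp
    qed auto
    finally show ?thesis using True finV by (simp add: L bern pmf_Pi)
  qed
qed

text \<open>The exponential supermartingale carried over to \<open>D\<close>: with sampling
  probabilities at least \<open>1 / (1 + c)\<close>, the sampled active weight rarely falls far
  below the fraction \<open>1 / (2 * (1 + c))\<close> of all active weight.\<close>

lemma prob_sample_deviation_le:
  fixes x :: "'a \<Rightarrow> real" and active :: "'a set \<Rightarrow> 'a \<Rightarrow> bool"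
  assumes ord: "linear_order_on V ord"
    and local: "\<And>S S' v. S \<subseteq> V \<Longrightarrow> S' \<subseteq> V \<Longrightarrow> {u\<in>S. prec ord u v} = {u\<in>S'. prec ord u v}
      \<Longrightarrow> active S v = active S' v"
    and x: "\<And>v. v \<in> V \<Longrightarrow> 0 \<le> x v \<and> x v \<le> 1"
  shows "measure_pmf.prob D {(VI, VS).
      (\<Sum>v\<in>{v\<in>V. active VS v}. x v) / (2 * (1 + c)) - (\<Sum>v\<in>{v\<in>V. active VS v \<and> v \<in> VS}. x v) \<ge> t}
    \<le> exp (- t)"
proof -
  define p where "p v = measure_pmf.prob D {(VI, VS). v \<in> VS}" for v
  define act where "act b v = active {u\<in>V. b u} v" for b v
  define f where "f b = (\<Sum>v\<in>{v\<in>V. act b v}. x v / (2 * (1 + c)) - (if b v then x v else 0))" for b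
  have "(\<integral>\<^sup>+b. ennreal (exp (f b)) \<partial>Pi_pmf V False (\<lambda>v. bernoulli_pmf (p v))) \<le> 1"
    unfolding f_def
  proof (rule nn_integral_exp_adapted_le_1[OF ord])
    show "act b v = act b' v" if "\<And>u. prec ord u v \<Longrightarrow> b u = b' u" for b b' v
      unfolding act_def by (rule local) (use that in auto)
    show "p v * exp (x v / (2 * (1 + c)) - x v) + (1 - p v) * exp (x v / (2 * (1 + c))) \<le> 1"
      if "v \<in> V" for v
      using that c x[OF that] model_sample_prob_ge
      by (intro sampling_step_le_1) (auto simp: p_def)
  qed (auto simp: finV p_def)
  then have "measure_pmf.prob (map_pmf (\<lambda>(VI, VS) v. v \<in> VS) D) {b. f b \<ge> t} \<le> exp (- t)"
    unfolding model_sample_law p_def by (rule prob_ge_le_exp)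
  also have "measure_pmf.prob (map_pmf (\<lambda>(VI, VS) v. v \<in> VS) D) {b. f b \<ge> t} =
      measure_pmf.prob D {(VI, VS). f (\<lambda>v. v \<in> VS) \<ge> t}"
    by (simp add: vimage_def case_prod_unfold)
  also have "\<dots> = measure_pmf.prob D {(VI, VS).
      (\<Sum>v\<in>{v\<in>V. active VS v}. x v) / (2 * (1 + c)) - (\<Sum>v\<in>{v\<in>V. active VS v \<and> v \<in> VS}. x v) \<ge> t}"
  \<comment> \<open>The events agree only on the support, where
    \<open>VS \<subseteq> V\<close>.\<close>
  proof (rule measure_pmf.finite_measure_eq_AE)
    have "f (\<lambda>v. v \<in> VS) = (\<Sum>v\<in>{v\<in>V. active VS v}. x v) / (2 * (1 + c)) -
        (\<Sum>v\<in>{v\<in>V. active VS v \<and> v \<in> VS}. x v)" if "(VI, VS) \<in> set_pmf D" for VI VS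
    proof -
      have "{u\<in>V. u \<in> VS} = VS" using model_support[OF that] by auto
      moreover have "{v\<in>V. active VS v \<and> v \<in> VS} = {v\<in>{v\<in>V. active VS v}. v \<in> VS}" by auto
      ultimately show ?thesis
        using finV by (simp add: f_def act_def sum_subtractf sum_divide_distrib
            sum.inter_filter[symmetric] del: mem_Collect_eq)
    qed
    then show "AE z in D. (z \<in> {(VI, VS). f (\<lambda>v. v \<in> VS) \<ge> t}) = (z \<in> {(VI, VS).
      (\<Sum>v\<in>{v\<in>V. active VS v}. x v) / (2 * (1 + c)) - (\<Sum>v\<in>{v\<in>V. active VS v \<and> v \<in> VS}. x v) \<ge> t})"
      by (auto simp: AE_measure_pmf_iff)
  qed auto
  finally show ?thesis .
qed

end

section \<open>Candidates and failure probabilities\<close>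

text \<open>The nodes passing the test of the second phase if they arrive, so that
  \<open>M\<^sub>1\<close> and \<open>M\<^sub>2\<close> are the intersections of this set with the sample and the input set.\<close>

definition candidates :: "'a set \<Rightarrow> ('a \<Rightarrow> 'a \<Rightarrow> real) \<Rightarrow> 'a rel \<Rightarrow> 'a set \<Rightarrow> 'a set" where
  "candidates V w ord VS =
     {v\<in>V. (\<Sum>u\<in>{u\<in>sample_greedy w ord VS. prec ord u v}. wbar w u v) < 1}"

text \<open>Condition on the first stage: inside \<open>E\<close> the second-stage probability is
  bounded by 1, outside by \<open>d\<close>.\<close>

lemma prob_bind_pmf_le:
  assumes "\<And>x. x \<in> set_pmf M \<Longrightarrow> x \<notin> E \<Longrightarrow> measure_pmf.prob (N x) A \<le> d" and "0 \<le> d"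
  shows "measure_pmf.prob (bind_pmf M N) A \<le> measure_pmf.prob M E + d"
proof -
  have "ennreal (measure_pmf.prob (bind_pmf M N) A) = (\<integral>\<^sup>+x. emeasure (N x) A \<partial>M)"
    by (simp add: measure_pmf.emeasure_eq_measure[symmetric])
  also have "\<dots> \<le> (\<integral>\<^sup>+x. indicator E x + ennreal d \<partial>M)"
  proof (rule nn_integral_mono_AE, unfold AE_measure_pmf_iff, intro ballI)
    fix x assume x: "x \<in> set_pmf M"
    show "emeasure (N x) A \<le> indicator E x + ennreal d"
    proof (cases "x \<in> E")
      case True
      have "emeasure (N x) A \<le> 1" by (rule measure_pmf.emeasure_le_1)
      also have "\<dots> \<le> indicator E x + ennreal d" using True by simp
      finally show ?thesis .
    next
      case False
      then show ?thesis
        using assms(1)[OF x] by (simp add: measure_pmf.emeasure_eq_measure ennreal_leI)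
    qed
  qed
  also have "\<dots> = emeasure M E + ennreal d"
    by (subst nn_integral_add) auto
  also have "\<dots> = ennreal (measure_pmf.prob M E + d)"
    using assms(2) by (simp add: measure_pmf.emeasure_eq_measure ennreal_plus)
  finally show ?thesis using assms(2) by (subst (asm) ennreal_le_iff) auto
qed

text \<open>The leading factor of \<open>tau\<close> is at least \<open>12 * (1 + c)\<close>,
  because \<open>4 * c \<le> (1 + c)^2\<close>, and at least \<open>3 * (1 + c)^2\<close>. The first
  bound serves large graphs, the second the trivial estimate for small ones.\<close>

lemma tau_ge:
  assumes "c \<ge> 1" "\<rho> \<ge> 0" "of_int \<lceil>log 2 m\<rceil> \<ge> (2::real)"
  shows "tau \<rho> c m \<ge> 12 * (1 + c) * (2 * \<rho> * of_int \<lceil>log 2 m\<rceil> + 1)"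
    and "tau \<rho> c m \<ge> 12 * (1 + c)\<^sup>2 * \<rho>"
proof -
  define L :: real where "L = of_int \<lceil>log 2 m\<rceil>"
  define K where "K = (3 * (1 + c) ^ 3 + c) / c"
  have L: "L \<ge> 2" using assms by (simp add: L_def)
  have "12 * (1 + c) * c \<le> 3 * (1 + c) ^ 3"
  proof -
    have "4 * c \<le> (1 + c)\<^sup>2" using zero_le_power2[of "1 - c"] by (simp add: power2_eq_square algebra_simps)
    then have "3 * (1 + c) * (4 * c) \<le> 3 * (1 + c) * (1 + c)\<^sup>2"
      using assms(1) by (intro mult_left_mono) auto
    then show ?thesis by (simp add: power3_eq_cube power2_eq_square algebra_simps)
  qed
  then have K1: "12 * (1 + c) \<le> K" using assms(1) by (simp add: K_def field_simps)
  have "3 * (1 + c)\<^sup>2 * c \<le> 3 * (1 + c)\<^sup>2 * (1 + c)"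
    using assms(1) by (intro mult_left_mono) auto
  then have "3 * (1 + c)\<^sup>2 * c \<le> 3 * (1 + c) ^ 3"
    by (simp add: power3_eq_cube power2_eq_square algebra_simps)
  then have "3 * (1 + c)\<^sup>2 * c \<le> 3 * (1 + c) ^ 3 + c" using assms(1) by linarith
  then have K2: "3 * (1 + c)\<^sup>2 \<le> K" unfolding K_def using assms(1) by (subst pos_le_divide_eq) auto
  have tau: "tau \<rho> c m = K * (2 * \<rho> * L + 1)" by (simp add: tau_def K_def L_def)
  have "0 \<le> \<rho> * L" using assms L by simp
  then show "tau \<rho> c m \<ge> 12 * (1 + c) * (2 * \<rho> * of_int \<lceil>log 2 m\<rceil> + 1)"
    unfolding tau L_def[symmetric] using K1 by (intro mult_right_mono) auto
  have "\<rho> * 2 \<le> \<rho> * L" using assms L by (intro mult_left_mono) auto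
  then have "3 * (1 + c)\<^sup>2 * (4 * \<rho>) \<le> K * (2 * \<rho> * L + 1)"
    using assms K2 by (intro mult_mono) (auto intro: order_trans[OF _ K2])
  then show "tau \<rho> c m \<ge> 12 * (1 + c)\<^sup>2 * \<rho>" by (simp add: tau)
qed

lemma n_tilde_ge:
  assumes "finite VS" "VS \<noteq> {}" "c \<ge> 1"
  shows "n_tilde c VS \<ge> c + 2" "n_tilde c VS \<ge> 3" "of_int \<lceil>log 2 (n_tilde c VS)\<rceil> \<ge> (2::real)"
    "real (card VS) < n_tilde c VS"
proof -
  have card: "1 \<le> real (card VS)"
    using assms card_gt_0_iff[of VS] by linarith
  then have "(c + 2) * 1 \<le> (c + 2) * real (card VS)" using assms by (intro mult_left_mono) auto
  then show 1: "n_tilde c VS \<ge> c + 2" by (simp add: n_tilde_def)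
  then show 3: "n_tilde c VS \<ge> 3" using assms by simp
  \<comment> \<open>Strictness matters: a logarithm above 1 has ceiling at least 2.\<close>
  have "log 2 2 < log 2 (n_tilde c VS)" using 3 by (subst log_less_cancel_iff) auto
  then have "1 < log 2 (n_tilde c VS)" by simp
  then have "1 < \<lceil>log 2 (n_tilde c VS)\<rceil>" by (simp add: less_ceiling_iff)
  then have "2 \<le> \<lceil>log 2 (n_tilde c VS)\<rceil>" by simp
  then show "of_int \<lceil>log 2 (n_tilde c VS)\<rceil> \<ge> (2::real)" by linarith
  have "1 * real (card VS) < (c + 2) * real (card VS)"
    using assms card by (intro mult_strict_right_mono) auto
  then show "real (card VS) < n_tilde c VS" by (simp add: n_tilde_def)
qed

section \<open>Degree bounds for candidates and failure of the coins\<close>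

context
  fixes V :: "'a set" and w :: "'a \<Rightarrow> 'a \<Rightarrow> real" and ord :: "'a rel" and \<rho> c :: real
  assumes graph: "conflict_graph V w" and ind: "inductive_order V w ord \<rho>" and c: "c \<ge> 1"
begin

lemma vertices_finite: "finite V"
  using graph by (simp add: conflict_graph_def)

lemma order_linear: "linear_order_on V ord"
  using ind by (simp add: inductive_order_def)

lemma sample_greedy_eq_candidates_inter:
  assumes "VS \<subseteq> V"
  shows "sample_greedy w ord VS = {v\<in>candidates V w ord VS. v \<in> VS}"
  using mem_sample_greedy_iff[OF order_linear finite_subset[OF assms vertices_finite] assms] assms
  unfolding candidates_def by blast

text \<open>Here \<open>n_tilde\<close> is 0, and the default values of the logarithm at 0 and of
  division by 0 make the threshold 0. Two distinct output nodes would need a negative mutual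
  weight.\<close>

lemma output_empty_sample:
  assumes "set xs \<subseteq> V"
  shows "independent_set V w (output_set w ord c {} xs B)" (is "independent_set V w ?M")
proof -
  have sub: "?M \<subseteq> V" using output_set_pairwise(1)[of w ord c "{}" xs B] assms by blast
  have eq: "u = v" if "u \<in> ?M" "v \<in> ?M" for u v
  proof (rule ccontr)
    assume "u \<noteq> v"
    from output_set_pairwise(2)[OF that this] have "wbar w u v < 0"
      by (simp add: n_tilde_def log_def)
    then show False using wbar_nonneg[OF graph ind, of u v] that sub by auto
  qed
  have "(\<Sum>u\<in>?M. w u v) < 1" if v: "v \<in> ?M" for v
  proof -
    have "?M = {v}" using eq v by auto
    then show ?thesis using graph sub by (auto simp: conflict_graph_def)
  qed
  then show ?thesis using sub by (simp add: independent_set_def)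
qed

text \<open>With both sets fixed, every violation is covered by events \<open>bad v\<close> that
  mention only the coins. The arrival order may thus depend on the coins, and a union bound over
  candidates suffices.\<close>

lemma coin_failure:
  assumes VI: "VI \<subseteq> V" and VS: "VS \<subseteq> V" "VS \<noteq> {}" and q: "0 \<le> q" "q \<le> 1"
    and q_le: "q \<le> 1 / (2 * exp 1 * tau \<rho> c (n_tilde c VS))"
    and good: "\<And>v. v \<in> candidates V w ord VS \<Longrightarrow>
      (\<Sum>u\<in>candidates V w ord VS. wbar w u v) \<le> tau \<rho> c (n_tilde c VS)"
    and arr: "\<And>B. set (arr B) = VI"
  shows "measure_pmf.prob (Pi_pmf VI False (\<lambda>_. bernoulli_pmf q))
      {B. \<not> independent_set V w (output_set w ord c VS (arr B) B)}
    \<le> real (card V) * (1 / n_tilde c VS ^ 10)"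
proof -
  let ?P = "Pi_pmf VI False (\<lambda>_. bernoulli_pmf q)"
  define N where "N = n_tilde c VS"
  define \<theta> where "\<theta> = 1 / (4 * exp 1 * log 2 N)"
  define C where "C = candidates V w ord VS"
  \<comment> \<open>Truncation makes every summand at most \<open>\<theta>\<close>, as the tail
    bound demands, and is invisible inside the output, whose pairwise weights are below
    \<open>\<theta>\<close>.\<close>
  define y where "y v u = (if u \<in> C \<and> wbar w u v < \<theta> then wbar w u v else 0)" for u v
  define bad where "bad v = {B. (\<Sum>u\<in>{u\<in>VI. B u}. y v u) \<ge> 1}" for v
  have finVI: "finite VI" using VI vertices_finite finite_subset by blast
  have CV: "C \<subseteq> V" by (auto simp: C_def candidates_def)
  have finC: "finite C" using CV vertices_finite finite_subset by blast
  have N3: "N \<ge> 3" using n_tilde_ge(2)[OF finite_subset[OF VS(1) vertices_finite] VS(2) c] by (simp add: N_def)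
  have L2: "of_int \<lceil>log 2 N\<rceil> \<ge> (2::real)"
    using n_tilde_ge(3)[OF finite_subset[OF VS(1) vertices_finite] VS(2) c] by (simp add: N_def)
  have logN: "log 2 N > 0" using N3 by simp
  then have \<theta>: "\<theta> > 0" by (simp add: \<theta>_def)
  have "\<rho> \<ge> 0" using inductive_order_bound_nonneg[OF graph ind] VS by blast
  have tau: "tau \<rho> c N > 0"
  proof -
    have "0 < 12 * (1 + c) * (2 * \<rho> * of_int \<lceil>log 2 N\<rceil> + 1)"
      using c \<open>\<rho> \<ge> 0\<close> L2 by (intro mult_pos_pos add_nonneg_pos mult_nonneg_nonneg) auto
    then show ?thesis using tau_ge(1)[OF c \<open>\<rho> \<ge> 0\<close> L2] by linarith
  qed
  have bad: "measure_pmf.prob ?P (bad v) \<le> 1 / N ^ 10" if v: "v \<in> C" for v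
  proof -
    have y0: "0 \<le> y v u \<and> y v u \<le> \<theta>" for u
      using v CV \<theta> wbar_nonneg[OF graph ind, of u v] by (auto simp: y_def)
    have "(\<Sum>u\<in>VI. y v u) = (\<Sum>u\<in>VI \<inter> C. y v u)"
      using finVI by (intro sum.mono_neutral_right) (auto simp: y_def)
    also have "\<dots> \<le> (\<Sum>u\<in>VI \<inter> C. wbar w u v)"
      using v CV wbar_nonneg[OF graph ind, of _ v] by (intro sum_mono) (auto simp: y_def)
    also have "\<dots> \<le> (\<Sum>u\<in>C. wbar w u v)"
      using v CV finC wbar_nonneg[OF graph ind, of _ v] by (intro sum_mono2) auto
    also have "\<dots> \<le> tau \<rho> c N" using good v by (simp add: C_def N_def)
    finally have sum: "(\<Sum>u\<in>VI. y v u) \<le> tau \<rho> c N" .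
    have "q * (\<Sum>u\<in>VI. y v u) \<le> 1 / (2 * exp 1 * tau \<rho> c N) * tau \<rho> c N"
      using q_le q sum y0 tau by (intro mult_mono sum_nonneg) (auto simp: N_def)
    also have "\<dots> = 1 / (2 * exp 1)" using tau by simp
    finally have mean: "q * (\<Sum>u\<in>VI. y v u) \<le> 1 / (2 * exp 1)" .
    have "measure_pmf.prob ?P (bad v) \<le> 2 powr (- 1 / \<theta>)"
      unfolding bad_def by (rule bernoulli_sum_tail) (use finVI q \<theta> y0 mean in auto)
    also have "- 1 / \<theta> = log 2 N * (- (4 * exp 1))" by (simp add: \<theta>_def)
    also have "2 powr (log 2 N * (- (4 * exp 1))) = (2 powr log 2 N) powr (- (4 * exp 1))"
      by (simp only: powr_powr)
    also have "2 powr log 2 N = N" using N3 by simp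
    \<comment> \<open>\<open>exp 1 \<ge> 1 + 1 + 1/2\<close> gives
      \<open>4 * exp 1 \<ge> 10\<close>.\<close>
    also have "N powr (- (4 * exp 1)) \<le> N powr (- 10)"
      using N3 exp_lower_Taylor_quadratic[of 1] by (intro powr_mono) auto
    also have "\<dots> = 1 / N ^ 10" using N3 by (simp add: powr_minus_divide powr_numeral)
    finally show ?thesis .
  qed
  have "{B. \<not> independent_set V w (output_set w ord c VS (arr B) B)} \<subseteq> (\<Union>v\<in>C. bad v)"
  proof
    fix B assume B: "B \<in> {B. \<not> independent_set V w (output_set w ord c VS (arr B) B)}"
    define M where "M = output_set w ord c VS (arr B) B"
    have M: "M \<subseteq> {v\<in>VI. B v} \<inter> C"
      using output_set_pairwise(1)[of w ord c VS "arr B" B] arr VI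
      by (auto simp: M_def C_def candidates_def)
    have pair: "wbar w u v < \<theta>" if "u \<in> M" "v \<in> M" "u \<noteq> v" for u v
      using output_set_pairwise(2)[of u w ord c VS "arr B" B v] that
      by (simp add: M_def \<theta>_def N_def)
    have MV: "M \<subseteq> V" using M VI by auto
    then obtain v where v: "v \<in> M" "(\<Sum>u\<in>M. w u v) \<ge> 1"
      using B by (auto simp: independent_set_def M_def not_less)
    have vV: "v \<in> V" using v MV by auto
    note v(2)
    also have "(\<Sum>u\<in>M. w u v) \<le> (\<Sum>u\<in>M. y v u)"
    proof (rule sum_mono)
      fix u assume u: "u \<in> M"
      then have uV: "u \<in> V" using MV by auto
      have uC: "u \<in> C" using u M by auto
      show "w u v \<le> y v u"
      proof (cases "u = v")
        case True
        then show ?thesis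
          using graph vV wbar_nonneg[OF graph ind vV vV] by (auto simp: conflict_graph_def y_def)
      next
        case False
        have "0 \<le> w v u" using graph uV vV by (auto simp: conflict_graph_def)
        then show ?thesis using pair[OF u v(1) False] uC by (auto simp: y_def wbar_def)
      qed
    qed
    also have "\<dots> \<le> (\<Sum>u\<in>{u\<in>VI. B u}. y v u)"
      using M finVI VI vV wbar_nonneg[OF graph ind, of _ v]
      by (intro sum_mono2) (auto simp: y_def)
    finally show "B \<in> (\<Union>v\<in>C. bad v)" using v M by (auto simp: bad_def)
  qed
  then have "measure_pmf.prob ?P {B. \<not> independent_set V w (output_set w ord c VS (arr B) B)}
      \<le> measure_pmf.prob ?P (\<Union>v\<in>C. bad v)"
    by (intro measure_pmf.finite_measure_mono) auto
  also have "\<dots> \<le> (\<Sum>v\<in>C. measure_pmf.prob ?P (bad v))"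
    by (rule measure_UNION_le) (use finC in auto)
  also have "\<dots> \<le> (\<Sum>v\<in>C. 1 / N ^ 10)" by (intro sum_mono bad)
  also have "\<dots> \<le> real (card V) * (1 / N ^ 10)"
    using card_mono[OF vertices_finite CV] N3 by (simp add: divide_right_mono)
  finally show ?thesis by (simp add: N_def)
qed

text \<open>There are at most \<open>12 * (1 + c)^2\<close> summands, none above
  \<open>\<rho>\<close>.\<close>

lemma candidate_sum_small:
  assumes VS: "VS \<subseteq> V" "VS \<noteq> {}" and "v \<in> V" and "real (card V) \<le> 12 * (1 + c)\<^sup>2"
  shows "(\<Sum>u\<in>candidates V w ord VS. wbar w u v) \<le> tau \<rho> c (n_tilde c VS)"
proof -
  have \<rho>: "\<rho> \<ge> 0" using inductive_order_bound_nonneg[OF graph ind] assms by blast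
  have sub: "candidates V w ord VS \<subseteq> V" by (auto simp: candidates_def)
  have "(\<Sum>u\<in>candidates V w ord VS. wbar w u v) \<le> (\<Sum>u\<in>candidates V w ord VS. \<rho>)"
    using sub assms wbar_le_inductive_bound[OF graph ind] by (intro sum_mono) auto
  also have "\<dots> \<le> real (card V) * \<rho>"
    using card_mono[OF vertices_finite sub] \<rho> by (simp add: mult_right_mono)
  also have "\<dots> \<le> 12 * (1 + c)\<^sup>2 * \<rho>" using assms(4) \<rho> by (intro mult_right_mono) auto
  also have "\<dots> \<le> tau \<rho> c (n_tilde c VS)"
    using tau_ge(2)[OF c \<rho> n_tilde_ge(3)[OF finite_subset[OF VS(1) vertices_finite] VS(2) c]] .
  finally show ?thesis .
qed

text \<open>Towards \<open>M1\<close>, a candidate has backward degree below 1 and forward degree at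
  most \<open>4 * \<rho> * L\<close>. The deviation term adds at most \<open>4 * \<rho> * L\<close>
  more, as \<open>ln n \<le> 2 * L\<close>.\<close>

lemma candidate_sum_large:
  assumes VS: "VS \<subseteq> V" "VS \<noteq> {}" and v: "v \<in> candidates V w ord VS"
    and "1 \<le> n" "sqrt n \<le> n_tilde c VS"
    and dev: "(\<Sum>u\<in>candidates V w ord VS. wbar w u v) \<le>
      2 * (1 + c) * ((\<Sum>u\<in>sample_greedy w ord VS. wbar w u v) + 2 * \<rho> * ln n)"
  shows "(\<Sum>u\<in>candidates V w ord VS. wbar w u v) \<le> tau \<rho> c (n_tilde c VS)"
proof -
  define N where "N = n_tilde c VS"
  define L where "L = \<lceil>log 2 N\<rceil>"
  define M where "M = sample_greedy w ord VS"
  have vV: "v \<in> V" using v by (auto simp: candidates_def)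
  have \<rho>: "\<rho> \<ge> 0" using inductive_order_bound_nonneg[OF graph ind vV] .
  have finVS: "finite VS" using VS vertices_finite finite_subset by blast
  note N = n_tilde_ge[OF finVS VS(2) c, folded N_def]
  have L2: "real_of_int L \<ge> 2" using N(3) by (simp add: L_def)
  have M: "M \<subseteq> VS" and below: "\<And>x. x \<in> M \<Longrightarrow> (\<Sum>u\<in>{u\<in>M. prec ord u x}. wbar w u x) < 1"
    using mem_sample_greedy_iff[OF order_linear finVS VS(1), of _ w, THEN iffD1] unfolding M_def by blast+
  have finM: "finite M" using M finVS finite_subset by blast
  have MV: "M \<subseteq> V" using M VS by blast
  have "real (card M) \<le> real (card VS)" using card_mono[OF finVS M] by simp
  also have "\<dots> < N" by (rule N(4))
  also have "\<dots> = 2 powr log 2 N" using N by simp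
  also have "\<dots> \<le> 2 powr real (nat L)"
    using L2 by (intro powr_mono) (auto simp: L_def le_of_int_ceiling)
  also have "\<dots> = real (2 ^ nat L)" by (simp add: powr_realpow)
  finally have "card M < 2 ^ nat L" by (simp only: of_nat_less_iff)
  then have "(\<Sum>u\<in>{u\<in>M. prec ord v u}. wbar w u v) \<le> 4 * \<rho> * real (nat L)"
    by (rule forward_sum_log_bound[OF graph ind vV MV]) (rule below)
  then have fwd: "(\<Sum>u\<in>{u\<in>M. prec ord v u}. wbar w u v) \<le> 4 * \<rho> * L" using L2 by simp
  have bwd: "(\<Sum>u\<in>{u\<in>M. prec ord u v}. wbar w u v) \<le> 1"
    using v by (simp add: candidates_def M_def)
  have "(\<Sum>u\<in>M. wbar w u v) =
      (\<Sum>u\<in>{u\<in>M. prec ord u v} \<union> {u\<in>M. prec ord v u}. wbar w u v)"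
  proof (rule sum.mono_neutral_right)
    \<comment> \<open>The only node in neither half can be \<open>v\<close> itself, with weight
      0.\<close>
    show "\<forall>u\<in>M - ({u\<in>M. prec ord u v} \<union> {u\<in>M. prec ord v u}). wbar w u v = 0"
    proof
      fix u assume u: "u \<in> M - ({u\<in>M. prec ord u v} \<union> {u\<in>M. prec ord v u})"
      then have "u = v" using prec_total[OF order_linear, of u v] MV vV by blast
      then show "wbar w u v = 0" using wbar_diag[OF graph ind vV] by simp
    qed
  qed (use finM in auto)
  also have "\<dots> = (\<Sum>u\<in>{u\<in>M. prec ord u v}. wbar w u v) + (\<Sum>u\<in>{u\<in>M. prec ord v u}. wbar w u v)"
    by (rule sum.union_disjoint) (use finM prec_asym[OF order_linear] in auto)
  finally have sumM: "(\<Sum>u\<in>M. wbar w u v) \<le> 1 + 4 * \<rho> * L" using fwd bwd by linarith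
  \<comment> \<open>\<open>n\<close> is at most the square of \<open>N\<close>, and
    \<open>ln\<close> is at most the binary logarithm on \<open>N \<ge> 3\<close>.\<close>
  have "ln n \<le> 2 * L"
  proof -
    have "ln n = 2 * ln (sqrt n)" using assms(4) by (simp add: ln_sqrt)
    also have "\<dots> \<le> 2 * ln N" using assms N by (simp add: N_def)
    also have "ln N = ln 2 * log 2 N" by (simp add: log_def)
    also have "\<dots> \<le> 1 * log 2 N"
      using N ln_le_minus_one[of "2::real"] by (intro mult_right_mono) auto
    also have "\<dots> \<le> L" by (simp add: L_def)
    finally show ?thesis by simp
  qed
  then have "\<rho> * ln n \<le> \<rho> * (2 * L)" using \<rho> by (rule mult_left_mono)
  then have "(\<Sum>u\<in>M. wbar w u v) + 2 * \<rho> * ln n \<le> 1 + 8 * \<rho> * L" using sumM by linarith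
  then have "2 * (1 + c) * ((\<Sum>u\<in>M. wbar w u v) + 2 * \<rho> * ln n) \<le>
      2 * (1 + c) * (1 + 8 * \<rho> * L)"
    using c by (intro mult_left_mono) auto
  also have "\<dots> \<le> 2 * (1 + c) * (6 * (2 * \<rho> * L + 1))"
    using c \<rho> L2 by (intro mult_left_mono) auto
  also have "\<dots> \<le> tau \<rho> c N"
    using tau_ge(1)[OF c \<rho> N(3)] by (simp add: L_def algebra_simps)
  finally show ?thesis using dev by (simp add: M_def N_def)
qed

text \<open>The deviation bound with weights divided by \<open>\<rho>\<close>, candidates as active
  nodes and \<open>t = 2 * ln n\<close>; the square leaves room for a union bound over all nodes. If
  \<open>\<rho> = 0\<close>, all weights vanish and the event is empty.\<close>

lemma prob_candidate_deviation_le: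
  assumes model: "graph_sampling_model V c D" and v: "v \<in> V" and n: "1 \<le> n"
  shows "measure_pmf.prob D {(VI, VS). VS \<subseteq> V \<and> (\<Sum>u\<in>candidates V w ord VS. wbar w u v) >
      2 * (1 + c) * ((\<Sum>u\<in>sample_greedy w ord VS. wbar w u v) + 2 * \<rho> * ln n)} \<le> 1 / n\<^sup>2"
    (is "measure_pmf.prob D ?E \<le> _")
proof (cases "\<rho> = 0")
  case True
  have "wbar w u v = 0" if "u \<in> V" for u
    using wbar_le_inductive_bound[OF graph ind that v] wbar_nonneg[OF graph ind that v] True by simp
  then have "(\<Sum>u\<in>S. wbar w u v) = 0" if "S \<subseteq> V" for S
    using that by (intro sum.neutral) auto
  moreover have "candidates V w ord VS \<subseteq> V" for VS by (auto simp: candidates_def)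
  moreover have "sample_greedy w ord VS \<subseteq> V" if "VS \<subseteq> V" for VS
    unfolding sample_greedy_eq_candidates_inter[OF that] by (auto simp: candidates_def)
  ultimately have "?E = {}" using True by auto
  then have "measure_pmf.prob D ?E = 0" by (simp only: measure_empty)
  then show ?thesis by simp
next
  case False
  then have \<rho>: "\<rho> > 0" using inductive_order_bound_nonneg[OF graph ind v] by simp
  define active where
    "active VS u \<longleftrightarrow> (\<Sum>t\<in>{t\<in>sample_greedy w ord VS. prec ord t u}. wbar w t u) < 1" for VS u
  define x where "x u = wbar w u v / \<rho>" for u
  have cand: "{u\<in>V. active VS u} = candidates V w ord VS" for VS
    by (auto simp: active_def candidates_def)
  have "measure_pmf.prob D {(VI, VS).
      (\<Sum>u\<in>{u\<in>V. active VS u}. x u) / (2 * (1 + c)) - (\<Sum>u\<in>{u\<in>V. active VS u \<and> u \<in> VS}. x u)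
        \<ge> 2 * ln n} \<le> exp (- (2 * ln n))"
  proof (rule prob_sample_deviation_le[OF vertices_finite c model order_linear])
    fix S S' u assume "S \<subseteq> V" "S' \<subseteq> V" "{t\<in>S. prec ord t u} = {t\<in>S'. prec ord t u}"
    then show "active S u = active S' u"
      unfolding active_def using sample_greedy_below_cong[OF order_linear vertices_finite, of S S' u w] by simp
  next
    fix u assume "u \<in> V"
    then show "0 \<le> x u \<and> x u \<le> 1"
      using \<rho> wbar_nonneg[OF graph ind _ v] wbar_le_inductive_bound[OF graph ind _ v]
      by (simp add: x_def)
  qed
  also have "exp (- (2 * ln n)) = 1 / n\<^sup>2"
    using n exp_double[of "ln n"] by (simp add: exp_minus inverse_eq_divide)
  finally have *: "measure_pmf.prob D {(VI, VS).
      (\<Sum>u\<in>{u\<in>V. active VS u}. x u) / (2 * (1 + c)) - (\<Sum>u\<in>{u\<in>V. active VS u \<and> u \<in> VS}. x u)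
        \<ge> 2 * ln n} \<le> 1 / n\<^sup>2" (is "measure_pmf.prob D ?F \<le> _") .
  have "?E \<subseteq> ?F"
  proof safe
    fix VI VS
    assume VS: "VS \<subseteq> V"
      and gt: "(\<Sum>u\<in>candidates V w ord VS. wbar w u v) >
        2 * (1 + c) * ((\<Sum>u\<in>sample_greedy w ord VS. wbar w u v) + 2 * \<rho> * ln n)"
    have "{u\<in>V. active VS u \<and> u \<in> VS} = sample_greedy w ord VS"
      unfolding sample_greedy_eq_candidates_inter[OF VS] cand[symmetric] by auto
    moreover have "(\<Sum>u\<in>candidates V w ord VS. wbar w u v) / (2 * (1 + c)) >
        (\<Sum>u\<in>sample_greedy w ord VS. wbar w u v) + 2 * \<rho> * ln n"
      using gt c by (subst pos_less_divide_eq) (auto simp: mult.commute)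
    then have "2 * ln n * \<rho> \<le>
        (\<Sum>u\<in>candidates V w ord VS. wbar w u v) / (2 * (1 + c)) - (\<Sum>u\<in>sample_greedy w ord VS. wbar w u v)"
      by (simp add: mult_ac)
    then have "2 * ln n \<le> ((\<Sum>u\<in>candidates V w ord VS. wbar w u v) / (2 * (1 + c))
        - (\<Sum>u\<in>sample_greedy w ord VS. wbar w u v)) / \<rho>"
      using \<rho> by (subst pos_le_divide_eq) auto
    ultimately show "(\<Sum>u\<in>{u\<in>V. active VS u}. x u) / (2 * (1 + c)) -
        (\<Sum>u\<in>{u\<in>V. active VS u \<and> u \<in> VS}. x u) \<ge> 2 * ln n"
      unfolding cand by (simp add: x_def sum_divide_distrib[symmetric] diff_divide_distrib mult.commute)
  qed
  then show ?thesis
    using * measure_pmf.finite_measure_mono[of ?E ?F D] by simp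
qed

text \<open>The deviation bound with every node active and of weight 1. A small sample has at most
  \<open>n / (6 * (1 + c))\<close> nodes, and \<open>ln n \<le> n / (3 * (1 + c))\<close>; together
  these are exactly the fraction \<open>n / (2 * (1 + c))\<close>.\<close>

lemma prob_small_sample_le:
  assumes model: "graph_sampling_model V c D" and "12 * (1 + c)\<^sup>2 < real (card V)"
  shows "measure_pmf.prob D {(VI, VS). VS \<subseteq> V \<and> n_tilde c VS < sqrt (card V)} \<le> 1 / card V"
    (is "measure_pmf.prob D ?E \<le> _")
proof -
  define n where "n = real (card V)"
  have "4 \<le> (1 + c)\<^sup>2" using c power_mono[of 2 "1 + c" 2] by simp
  then have n: "n \<ge> 48" using assms by (simp add: n_def)
  have "measure_pmf.prob D {(VI, VS).
      (\<Sum>u\<in>{u\<in>V. True}. 1::real) / (2 * (1 + c)) - (\<Sum>u\<in>{u\<in>V. True \<and> u \<in> VS}. 1) \<ge> ln n}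
    \<le> exp (- ln n)" (is "measure_pmf.prob D ?F \<le> _")
    by (rule prob_sample_deviation_le[OF vertices_finite c model order_linear]) auto
  also have "exp (- ln n) = 1 / n" using n by (simp add: exp_minus field_simps)
  finally have F: "measure_pmf.prob D ?F \<le> 1 / n" .
  have "?E \<subseteq> ?F"
  proof safe
    fix VI VS assume VS: "VS \<subseteq> V" and small: "n_tilde c VS < sqrt (card V)"
    have "{u\<in>V. u \<in> VS} = VS" using VS by auto
    moreover have "real (card VS) \<le> n / (6 * (1 + c))"
    proof -
      have "(1 + c) * real (card VS) \<le> (c + 2) * real (card VS)"
        using c by (intro mult_right_mono) auto
      also have "\<dots> \<le> sqrt n" using small by (simp add: n_tilde_def n_def)
      also have "\<dots> \<le> n / 6"
      proof (rule real_le_lsqrt)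
        have "36 * n \<le> n * n" using n by (intro mult_right_mono) auto
        then show "n \<le> (n / 6)\<^sup>2" by (simp add: power2_eq_square)
      qed (use n in auto)
      finally show ?thesis using c by (simp add: field_simps)
    qed
    moreover have "ln n \<le> n / (3 * (1 + c))"
    proof -
      \<comment> \<open>The fourth root gives
        \<open>ln n = 4 * ln s \<le> 4 * (s - 1) \<le> s^2 = sqrt n\<close>.\<close>
      define s where "s = sqrt (sqrt n)"
      have s: "s > 0" "s\<^sup>2 = sqrt n" "sqrt n * sqrt n = n" using n by (auto simp: s_def)
      have "ln n = 4 * ln s" using n by (simp add: s_def ln_sqrt)
      also have "\<dots> \<le> 4 * (s - 1)" using ln_le_minus_one[OF s(1)] by simp
      also have "\<dots> \<le> s\<^sup>2" using zero_le_power2[of "s - 2"] by (simp add: power2_eq_square algebra_simps)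
      finally have ln: "ln n \<le> sqrt n" using s by simp
      have "(3 * (1 + c))\<^sup>2 = 9 * (1 + c)\<^sup>2" unfolding power_mult_distrib by simp
      also have "\<dots> \<le> n" using assms(2) zero_le_power2[of "1 + c"] unfolding n_def by linarith
      finally have "(3 * (1 + c))\<^sup>2 \<le> n" .
      then have "3 * (1 + c) \<le> sqrt n" using real_le_rsqrt by blast
      then have "sqrt n * (3 * (1 + c)) \<le> sqrt n * sqrt n" using n by (intro mult_left_mono) auto
      then have "sqrt n \<le> n / (3 * (1 + c))" using s c by (subst pos_le_divide_eq) auto
      then show ?thesis using ln by simp
    qed
    moreover have "n / (2 * (1 + c)) = n / (6 * (1 + c)) + n / (3 * (1 + c))"
    proof -
      define t where "t = n / (1 + c)"
      have t: "n / (k * (1 + c)) = t / k" for k by (simp add: t_def)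
      show ?thesis unfolding t by simp
    qed
    ultimately show "(\<Sum>u\<in>{u\<in>V. True}. 1::real) / (2 * (1 + c)) - (\<Sum>u\<in>{u\<in>V. True \<and> u \<in> VS}. 1) \<ge> ln n"
      by (simp add: n_def)
  qed
  then show ?thesis
    using F measure_pmf.finite_measure_mono[of ?E ?F D] by (simp add: n_def)
qed

end

text \<open>For large \<open>n\<close>, failure is charged to three causes of probability at most
  \<open>1 / n\<close> each: a small sample, a degree deviation at some node, and unlucky coins. For
  small \<open>n\<close> the degree bound is certain and only the coins are charged.\<close>

theorem theorem14:
  fixes V :: "'a set" and w :: "'a \<Rightarrow> 'a \<Rightarrow> real" and ord :: "'a rel" and \<rho> c :: real
    and D :: "('a set \<times> 'a set) pmf" and q :: "'a set \<Rightarrow> real"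
    and arrival :: "'a set \<Rightarrow> 'a set \<Rightarrow> ('a \<Rightarrow> bool) \<Rightarrow> 'a list" and n :: nat
  assumes "conflict_graph V w"
    and "\<rho> = inductive_independence_number V w"
    and "inductive_order V w ord \<rho>"
    and "c \<ge> 1"
    and "graph_sampling_model V c D"
    and "\<And>VI VS. (VI, VS) \<in> set_pmf D \<Longrightarrow> n = card (VS \<union> VI)"
    and "\<And>VI VS B. (VI, VS) \<in> set_pmf D \<Longrightarrow> arrival VI VS B \<in> permutations_of_set VI"
    and "\<And>VI VS. (VI, VS) \<in> set_pmf D \<Longrightarrow> 0 \<le> q VS \<and> q VS \<le> 1"
    and "\<And>VI VS. (VI, VS) \<in> set_pmf D \<Longrightarrow> q VS \<le> 1 / (2 * exp 1 * tau \<rho> c (n_tilde c VS))"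
  shows "measure_pmf.prob (output_pmf w ord c D q arrival) {M\<^sub>4. independent_set V w M\<^sub>4}
           \<ge> 1 - 3 / real n"
proof -
  note graph = assms(1) and ind = assms(3) and c = assms(4) and model = assms(5)
  have finV: "finite V" using graph by (simp add: conflict_graph_def)
  define Bad where "Bad = {M. \<not> independent_set V w M}"
  define K where "K = (\<lambda>(VI, VS). map_pmf (\<lambda>B. output_set w ord c VS (arrival VI VS B) B)
    (Pi_pmf VI False (\<lambda>_. bernoulli_pmf (q VS))))"
  have output_eq: "output_pmf w ord c D q arrival = bind_pmf D K"
    by (simp add: output_pmf_def K_def map_pmf_def case_prod_unfold)
  obtain VI0 VS0 where "(VI0, VS0) \<in> set_pmf D" using set_pmf_not_empty[of D] by auto
  then have n: "n = card V" using assms(6) model_union[OF finV c model] by metis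
  \<comment> \<open>Failure for a fixed outcome of \<open>D\<close>. Both numeric premises are
    guarded by a nonempty sample, since an empty one never fails.\<close>
  have fail: "measure_pmf.prob (K (VI, VS)) Bad \<le> d"
    if supp: "(VI, VS) \<in> set_pmf D" and "0 \<le> d"
      and d: "VS \<noteq> {} \<Longrightarrow> VS \<subseteq> V \<Longrightarrow> real n * (1 / n_tilde c VS ^ 10) \<le> d"
      and good: "\<And>v. VS \<noteq> {} \<Longrightarrow> VS \<subseteq> V \<Longrightarrow> v \<in> candidates V w ord VS \<Longrightarrow>
        (\<Sum>u\<in>candidates V w ord VS. wbar w u v) \<le> tau \<rho> c (n_tilde c VS)" for VI VS d
  proof -
    have sub: "VI \<subseteq> V" "VS \<subseteq> V" using model_support[OF finV c model supp] by auto
    have arr: "set (arrival VI VS B) = VI" for B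
      using assms(7)[OF supp] by (rule permutations_of_setD)
    have K: "measure_pmf.prob (K (VI, VS)) Bad =
        measure_pmf.prob (Pi_pmf VI False (\<lambda>_. bernoulli_pmf (q VS)))
          {B. \<not> independent_set V w (output_set w ord c VS (arrival VI VS B) B)}"
      by (simp add: K_def Bad_def vimage_def)
    show ?thesis
    proof (cases "VS = {}")
      case True
      have "{B. \<not> independent_set V w (output_set w ord c VS (arrival VI VS B) B)} = {}"
        using output_empty_sample[OF graph ind c] arr sub unfolding True by blast
      then show ?thesis unfolding K using \<open>0 \<le> d\<close> by simp
    next
      case False
      have "measure_pmf.prob (K (VI, VS)) Bad \<le> real (card V) * (1 / n_tilde c VS ^ 10)"
        unfolding K
        by (rule coin_failure[OF graph ind c sub(1,2) False])
           (use assms(8)[OF supp] assms(9)[OF supp] good[OF False sub(2)] arr in auto)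
      also have "\<dots> \<le> d" using d[OF False sub(2)] by (simp add: n)
      finally show ?thesis .
    qed
  qed
  have "measure_pmf.prob (output_pmf w ord c D q arrival) Bad \<le> 3 / real n"
  proof (cases "real n \<le> 12 * (1 + c)\<^sup>2")
    case small: True
    \<comment> \<open>No outcome is exceptional. For \<open>n = 0\<close> the right-hand side is 0,
      which is correct because the sample is then empty.\<close>
    have "measure_pmf.prob (bind_pmf D K) Bad \<le> measure_pmf.prob D {} + 3 / real n"
    proof (rule prob_bind_pmf_le)
      fix x assume x: "x \<in> set_pmf D"
      obtain VI VS where xeq: "x = (VI, VS)" by (cases x)
      show "measure_pmf.prob (K x) Bad \<le> 3 / real n"
        unfolding xeq
      proof (rule fail)
        assume VS: "VS \<noteq> {}" "VS \<subseteq> V"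
        have "n > 0" using VS finV by (auto simp: n card_gt_0_iff)
        have N: "c + 2 \<le> n_tilde c VS"
          by (rule n_tilde_ge(1)[OF finite_subset[OF VS(2) finV] VS(1) c])
        \<comment> \<open>Smallness of \<open>n\<close> gives \<open>n^2 \<le> (c + 2)^10\<close>,
          using \<open>144 \<le> 3^6\<close>; a nonempty sample has \<open>n_tilde\<close> at least
          \<open>c + 2\<close>.\<close>
        have "(real n)\<^sup>2 \<le> (12 * (1 + c)\<^sup>2)\<^sup>2" using small by (intro power_mono) auto
        also have "\<dots> = 144 * (1 + c) ^ 4" by (simp add: power_mult_distrib flip: power_mult)
        also have "\<dots> \<le> (c + 2) ^ 6 * (c + 2) ^ 4"
        proof (rule mult_mono)
          have "(144::real) \<le> 3 ^ 6" by simp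
          also have "\<dots> \<le> (c + 2) ^ 6" using c by (intro power_mono) auto
          finally show "144 \<le> (c + 2) ^ 6" .
          show "(1 + c) ^ 4 \<le> (c + 2) ^ 4" using c by (intro power_mono) auto
        qed (use c in auto)
        also have "\<dots> = (c + 2) ^ 10" by (simp flip: power_add)
        also have "\<dots> \<le> n_tilde c VS ^ 10" using N c by (intro power_mono) auto
        finally have le: "(real n)\<^sup>2 \<le> n_tilde c VS ^ 10" .
        have pos: "0 < n_tilde c VS ^ 10" using N c by (intro zero_less_power) auto
        have "real n * real n \<le> 3 * n_tilde c VS ^ 10" using le pos unfolding power2_eq_square by linarith
        then show "real n * (1 / n_tilde c VS ^ 10) \<le> 3 / real n"
          using pos \<open>n > 0\<close> by (simp add: field_simps)
      next
        fix v assume VS: "VS \<noteq> {}" "VS \<subseteq> V" and v: "v \<in> candidates V w ord VS"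
        then have "v \<in> V" by (simp add: candidates_def)
        then show "(\<Sum>u\<in>candidates V w ord VS. wbar w u v) \<le> tau \<rho> c (n_tilde c VS)"
          by (rule candidate_sum_small[OF graph ind c VS(2,1)]) (use small n in simp)
      qed (use x xeq in auto)
    qed simp
    then show ?thesis by (simp add: output_eq)
  next
    case False
    then have large: "12 * (1 + c)\<^sup>2 < real (card V)" by (simp add: n)
    have "1 \<le> (1 + c)\<^sup>2" using c by (intro one_le_power) auto
    then have n1: "1 \<le> real n" using large n by linarith
    define E1 where "E1 = {(VI :: 'a set, VS). VS \<subseteq> V \<and> n_tilde c VS < sqrt (card V)}"
    define E2 where "E2 v = {(VI :: 'a set, VS). VS \<subseteq> V \<and> (\<Sum>u\<in>candidates V w ord VS. wbar w u v) >
      2 * (1 + c) * ((\<Sum>u\<in>sample_greedy w ord VS. wbar w u v) + 2 * \<rho> * ln (real n))}" for v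
    have E1: "measure_pmf.prob D E1 \<le> 1 / real n"
      using prob_small_sample_le[OF graph ind c model large] by (simp add: E1_def n)
    have "measure_pmf.prob D (\<Union>v\<in>V. E2 v) \<le> (\<Sum>v\<in>V. measure_pmf.prob D (E2 v))"
      by (rule measure_UNION_le) (use finV in auto)
    also have "\<dots> \<le> (\<Sum>v\<in>V. 1 / (real n)\<^sup>2)"
      unfolding E2_def by (intro sum_mono prob_candidate_deviation_le[OF graph ind c model _ n1])
    also have "\<dots> = 1 / real n" by (simp add: n power2_eq_square)
    finally have E2: "measure_pmf.prob D (\<Union>v\<in>V. E2 v) \<le> 1 / real n" .
    have "measure_pmf.prob (bind_pmf D K) Bad \<le>
        measure_pmf.prob D (E1 \<union> (\<Union>v\<in>V. E2 v)) + 1 / real n"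
    proof (rule prob_bind_pmf_le)
      fix x assume x: "x \<in> set_pmf D" "x \<notin> E1 \<union> (\<Union>v\<in>V. E2 v)"
      obtain VI VS where xeq: "x = (VI, VS)" by (cases x)
      have N: "sqrt (real n) \<le> n_tilde c VS" if "VS \<subseteq> V"
        using x(2) that by (auto simp: xeq E1_def n)
      show "measure_pmf.prob (K x) Bad \<le> 1 / real n"
        unfolding xeq
      proof (rule fail)
        assume VS: "VS \<noteq> {}" "VS \<subseteq> V"
        \<comment> \<open>Off \<open>E1\<close>, the tenth power of \<open>n_tilde\<close> is at
          least \<open>n^5\<close>, so the coins fail with probability at most
          \<open>1 / n\<close>.\<close>
        have "real n * real n \<le> real n ^ 5"
          using power_increasing[of 2 5 "real n"] n1 by (simp add: power2_eq_square)
        also have "real n ^ 5 = (sqrt (real n) ^ 2) ^ 5" by simp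
        also have "\<dots> = sqrt (real n) ^ 10" by (simp only: flip: power_mult) simp
        also have "\<dots> \<le> n_tilde c VS ^ 10" using N[OF VS(2)] by (intro power_mono) auto
        finally have le: "real n * real n \<le> n_tilde c VS ^ 10" .
        moreover have "0 < real n * real n" using n1 by (intro mult_pos_pos) auto
        ultimately have pos: "0 < n_tilde c VS ^ 10" by linarith
        show "real n * (1 / n_tilde c VS ^ 10) \<le> 1 / real n"
          using le pos n1 by (simp add: field_simps)
      next
        fix v assume VS: "VS \<noteq> {}" "VS \<subseteq> V" and v: "v \<in> candidates V w ord VS"
        then have "v \<in> V" by (simp add: candidates_def)
        then have "(\<Sum>u\<in>candidates V w ord VS. wbar w u v) \<le>
            2 * (1 + c) * ((\<Sum>u\<in>sample_greedy w ord VS. wbar w u v) + 2 * \<rho> * ln (real n))"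
          using x(2) VS(2) unfolding xeq E2_def by (auto simp: not_less)
        then show "(\<Sum>u\<in>candidates V w ord VS. wbar w u v) \<le> tau \<rho> c (n_tilde c VS)"
          by (rule candidate_sum_large[OF graph ind c VS(2,1) v n1 N[OF VS(2)]])
      qed (use x xeq in auto)
    qed simp
    also have "\<dots> \<le> 1 / real n + 1 / real n + 1 / real n"
      using measure_Un_le[of E1 "measure_pmf D" "\<Union>v\<in>V. E2 v"] E1 E2 by simp
    finally show ?thesis by (simp add: output_eq)
  qed
  moreover have "measure_pmf.prob (output_pmf w ord c D q arrival) {M\<^sub>4. independent_set V w M\<^sub>4} =
      1 - measure_pmf.prob (output_pmf w ord c D q arrival) Bad"
  proof -
    have "{M\<^sub>4. independent_set V w M\<^sub>4} = UNIV - Bad" by (auto simp: Bad_def)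
    then show ?thesis using measure_pmf.prob_compl[of Bad] by simp
  qed
  ultimately show ?thesis by simp
qed

end
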